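(* Let $k$ be an arbitrary field, $R$ a commutative $k$-algebra with a $k$-algebra automorphism $\sigma$, and $Q=R[t^{\pm1};\sigma]$ the skew Laurent polynomial ring. Suppose $A$ is a big subalgebra of $Q$. If $A$ has finite GK-dimension (respectively, subexponential growth), then every locally finite, finitely generated, $\mathbb{N}$-graded subalgebra of $Q$ has finite GK-dimension (respectively, subexponential growth).
   Context: $Q=R[t^{\pm1};\sigma]$ is $\mathbb{Z}$-graded with $R=Q_0$, $t\in Q_1$, and $tr=\sigma(r)t$ for $r\in R$. A graded algebra is locally finite if each graded piece is finite-dimensional over $k$. Big subalgebra: a locally finite $\mathbb{N}$-graded subalgebra $A=\bigoplus_{n\ge 0}V_nt^n\subset Q$ (with $V_n\subset R$) is big if there are $n\ge 1$ and $u\in V_n$ such that $u$ is a unit of $R$ and $R$ is a localization of its subalgebra $k[V_nu^{-1}]$ (the $k$-subalgebra generated by $V_nu^{-1}$) at some multiplicative system of nonzerodivisors of $k[V_nu^{-1}]$. Growth: for a $k$-algebra $A$, $\operatorname{GKdim}A=\sup_V\limsup_{n\to\infty}\log_n(\dim_kV^n)$, where $V$ ranges over all finite-dimensional $k$-subspaces of $A$ and $V^n$ is the span of products of $n$ elements of $V$. $A$ has exponential growth if $\sup_V\limsup_{n\to\infty}(\dim_kV^n)^{1/n}>1$, and subexponential growth otherwise. *)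

theory Defs
  imports
    Complex_Main
    "HOL-Library.Poly_Mapping"
    "HOL-Library.Extended_Real"
    "HOL-Library.Liminf_Limsup"
begin

section \<open>Algebras over a field and their growth\<close>

text \<open>
  Multiplication and unit are explicit parameters, because the multiplication of the skew
  Laurent polynomial ring depends on the automorphism.
\<close>

locale k_algebra = vector_space scale
  for scale :: "'k::field \<Rightarrow> 'a::ab_group_add \<Rightarrow> 'a" +
  fixes mult :: "'a \<Rightarrow> 'a \<Rightarrow> 'a"
    and one :: 'a
  assumes mult_assoc: "mult (mult x y) z = mult x (mult y z)"
    and mult_one_left: "mult one x = x"
    and mult_one_right: "mult x one = x"
    and mult_add_left: "mult (x + y) z = mult x z + mult y z"
    and mult_add_right: "mult x (y + z) = mult x y + mult x z"
    and mult_scale_left: "mult (scale c x) y = scale c (mult x y)"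
    and mult_scale_right: "mult x (scale c y) = scale c (mult x y)"
begin

definition subalgebra :: "'a set \<Rightarrow> bool"
  where "subalgebra A \<longleftrightarrow> subspace A \<and> one \<in> A \<and> (\<forall>x\<in>A. \<forall>y\<in>A. mult x y \<in> A)"

definition finitely_generated :: "'a set \<Rightarrow> bool"
  where "finitely_generated A \<longleftrightarrow> (\<exists>X. finite X \<and> A = subalgebra hull X)"

definition fd_subspace :: "'a set \<Rightarrow> bool"
  where "fd_subspace V \<longleftrightarrow> (\<exists>B. finite B \<and> V = span B)"

definition space_power :: "'a set \<Rightarrow> nat \<Rightarrow> 'a set"
  where "space_power V n = span {foldr mult xs one | xs. length xs = n \<and> set xs \<subseteq> V}"

text \<open>
  Since \<^term>\<open>log b 0 = 0\<close>, a subspace with \<open>V\<^sup>n = 0\<close> for large \<open>n\<close> contributes \<open>0\<close> rather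
  than \<open>-\<infinity>\<close>.  As \<open>k \<cdot> 1\<close> contributes \<open>0\<close> as well, this only matters for the
  zero algebra, which gets dimension \<open>0\<close>.
\<close>

definition GKdim :: "'a set \<Rightarrow> ereal"
  where "GKdim A = (SUP V\<in>{V. fd_subspace V \<and> V \<subseteq> A}.
    limsup (\<lambda>n. ereal (log (real n) (real (dim (space_power V n))))))"

definition exponential_growth :: "'a set \<Rightarrow> bool"
  where "exponential_growth A \<longleftrightarrow> (SUP V\<in>{V. fd_subspace V \<and> V \<subseteq> A}.
    limsup (\<lambda>n. ereal (root n (real (dim (space_power V n)))))) > 1"

definition finite_GKdim :: "'a set \<Rightarrow> bool"
  where "finite_GKdim A \<longleftrightarrow> GKdim A < \<infinity>"

definition subexponential_growth :: "'a set \<Rightarrow> bool"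
  where "subexponential_growth A \<longleftrightarrow> \<not> exponential_growth A"

end


section \<open>Localization\<close>

text \<open>
  The ambient ring \<open>R\<close> is the whole type; the subring \<open>B\<close> maps to it by inclusion, so that
  the kernel condition in the definition of a localization is automatic.
  The sort used for \<open>R\<close> is that of commutative unital rings in which \<open>0 = 1\<close> is allowed.
\<close>

definition multiplicative_system :: "'r::{comm_ring,comm_monoid_mult} set \<Rightarrow> bool"
  where "multiplicative_system S \<longleftrightarrow> 1 \<in> S \<and> (\<forall>s\<in>S. \<forall>s'\<in>S. s * s' \<in> S)"

definition nonzerodivisor_in :: "'r::{comm_ring,comm_monoid_mult} set \<Rightarrow> 'r \<Rightarrow> bool"
  where "nonzerodivisor_in B s \<longleftrightarrow> s \<in> B \<and> (\<forall>b\<in>B. s * b = 0 \<longrightarrow> b = 0)"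

definition is_localization_of :: "'r::{comm_ring,comm_monoid_mult} set \<Rightarrow> 'r set \<Rightarrow> bool"
  where "is_localization_of B S \<longleftrightarrow>
    (\<forall>s\<in>S. s dvd 1) \<and> (\<forall>r. \<exists>b\<in>B. \<exists>s\<in>S. r * s = b)"


section \<open>Skew Laurent polynomial rings\<close>

text \<open>
  An element of \<open>R[t\<^sup>\<plusminus>\<^sup>1; \<sigma>]\<close> is a finitely supported function from the integers to \<open>R\<close>;
  \<open>single n r\<close> is \<open>r t\<^sup>n\<close>.  The library's convolution product \<open>(*)\<close> on this type is the
  untwisted one and is not used.
\<close>

definition int_iterate :: "('r \<Rightarrow> 'r) \<Rightarrow> int \<Rightarrow> 'r \<Rightarrow> 'r"
  where "int_iterate \<sigma> i = (if i \<ge> 0 then \<sigma> ^^ nat i else inv \<sigma> ^^ nat (- i))"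

definition skew_scale :: "('k \<Rightarrow> 'r \<Rightarrow> 'r) \<Rightarrow> 'k \<Rightarrow> (int \<Rightarrow>\<^sub>0 'r::zero) \<Rightarrow> (int \<Rightarrow>\<^sub>0 'r)"
  where "skew_scale scale c = Poly_Mapping.map (scale c)"

definition skew_mult ::
  "('r \<Rightarrow> 'r) \<Rightarrow> (int \<Rightarrow>\<^sub>0 'r::{comm_ring,comm_monoid_mult}) \<Rightarrow> (int \<Rightarrow>\<^sub>0 'r) \<Rightarrow> (int \<Rightarrow>\<^sub>0 'r)"
  where "skew_mult \<sigma> p q = (\<Sum>i\<in>Poly_Mapping.keys p. \<Sum>j\<in>Poly_Mapping.keys q.
    Poly_Mapping.single (i + j)
      (Poly_Mapping.lookup p i * int_iterate \<sigma> i (Poly_Mapping.lookup q j)))"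

abbreviation skew_one :: "int \<Rightarrow>\<^sub>0 'r::{comm_ring,comm_monoid_mult}"
  where "skew_one \<equiv> Poly_Mapping.single 0 1"

locale skew_laurent =
  R: k_algebra scale "(*)" 1
  for scale :: "'k::field \<Rightarrow> 'r::{comm_ring,comm_monoid_mult} \<Rightarrow> 'r" +
  fixes \<sigma> :: "'r \<Rightarrow> 'r"
  assumes bij_sigma: "bij \<sigma>"
    and sigma_add: "\<sigma> (x + y) = \<sigma> x + \<sigma> y"
    and sigma_mult: "\<sigma> (x * y) = \<sigma> x * \<sigma> y"
    and sigma_one: "\<sigma> 1 = 1"
    and sigma_scale: "\<sigma> (scale c x) = scale c (\<sigma> x)"
begin

lemma inv_sigma: "\<sigma> (inv \<sigma> x) = x" "inv \<sigma> (\<sigma> x) = x"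
  using bij_sigma by (simp_all add: bij_is_surj surj_f_inv_f bij_is_inj inv_f_f)

lemma inv_sigma_hom:
  "inv \<sigma> (x + y) = inv \<sigma> x + inv \<sigma> y"
  "inv \<sigma> (x * y) = inv \<sigma> x * inv \<sigma> y"
  "inv \<sigma> 1 = 1"
  "inv \<sigma> (scale c x) = scale c (inv \<sigma> x)"
  by (metis inv_sigma sigma_add sigma_mult sigma_one sigma_scale)+

lemma int_iterate_0 [simp]: "int_iterate \<sigma> 0 x = x"
  by (simp add: int_iterate_def)

lemma int_iterate_hom:
  "int_iterate \<sigma> i (x + y) = int_iterate \<sigma> i x + int_iterate \<sigma> i y"
  "int_iterate \<sigma> i (x * y) = int_iterate \<sigma> i x * int_iterate \<sigma> i y"
  "int_iterate \<sigma> i 1 = 1"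
  "int_iterate \<sigma> i (scale c x) = scale c (int_iterate \<sigma> i x)"
proof -
  have *: "(f ^^ n) (x + y) = (f ^^ n) x + (f ^^ n) y \<and> (f ^^ n) (x * y) = (f ^^ n) x * (f ^^ n) y
      \<and> (f ^^ n) 1 = 1 \<and> (f ^^ n) (scale c x) = scale c ((f ^^ n) x)"
    if "f = \<sigma> \<or> f = inv \<sigma>" for f n
    using that
    by (induction n)
      (auto simp: sigma_add sigma_mult sigma_one sigma_scale inv_sigma_hom)
  show
    "int_iterate \<sigma> i (x + y) = int_iterate \<sigma> i x + int_iterate \<sigma> i y"
    "int_iterate \<sigma> i (x * y) = int_iterate \<sigma> i x * int_iterate \<sigma> i y"
    "int_iterate \<sigma> i 1 = 1"
    "int_iterate \<sigma> i (scale c x) = scale c (int_iterate \<sigma> i x)"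
    using * by (auto simp: int_iterate_def)
qed

lemma int_iterate_zero [simp]: "int_iterate \<sigma> i 0 = 0"
  using int_iterate_hom(1)[of i 0 0] by simp

lemma int_iterate_Suc: "int_iterate \<sigma> (i + 1) x = \<sigma> (int_iterate \<sigma> i x)"
proof (cases "i \<ge> 0")
  case True
  then have "nat (i + 1) = Suc (nat i)" by simp
  with True show ?thesis by (simp add: int_iterate_def)
next
  case False
  then have *: "nat (- i) = Suc (nat (- (i + 1)))" by simp
  have "int_iterate \<sigma> i x = inv \<sigma> ((inv \<sigma> ^^ nat (- (i + 1))) x)"
    using False unfolding int_iterate_def * by simp
  moreover have "int_iterate \<sigma> (i + 1) x = (inv \<sigma> ^^ nat (- (i + 1))) x"
    using False by (cases "i = -1") (auto simp: int_iterate_def)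
  ultimately show ?thesis by (simp add: inv_sigma)
qed

lemma int_iterate_pred: "int_iterate \<sigma> (i - 1) x = inv \<sigma> (int_iterate \<sigma> i x)"
  using int_iterate_Suc[of "i - 1" x] by (simp add: inv_sigma)

lemma int_iterate_add: "int_iterate \<sigma> (i + j) x = int_iterate \<sigma> i (int_iterate \<sigma> j x)"
proof (induction i rule: int_induct[where k = 0])
  case base
  then show ?case by simp
next
  case (step1 i)
  have "i + 1 + j = i + j + 1" by simp
  with step1 show ?case by (metis int_iterate_Suc)
next
  case (step2 i)
  have "i - 1 + j = i + j - 1" by simp
  with step2 show ?case by (metis int_iterate_pred)
qed

lemma skew_mult_superset:
  assumes "finite I" "Poly_Mapping.keys p \<subseteq> I" "finite J" "Poly_Mapping.keys q \<subseteq> J"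
  shows "skew_mult \<sigma> p q = (\<Sum>i\<in>I. \<Sum>j\<in>J. Poly_Mapping.single (i + j)
      (Poly_Mapping.lookup p i * int_iterate \<sigma> i (Poly_Mapping.lookup q j)))"
proof -
  have "skew_mult \<sigma> p q = (\<Sum>i\<in>Poly_Mapping.keys p. \<Sum>j\<in>J. Poly_Mapping.single (i + j)
      (Poly_Mapping.lookup p i * int_iterate \<sigma> i (Poly_Mapping.lookup q j)))"
    unfolding skew_mult_def
    by (intro sum.cong refl sum.mono_neutral_left) (use assms in \<open>auto simp: in_keys_iff\<close>)
  also have "\<dots> = (\<Sum>i\<in>I. \<Sum>j\<in>J. Poly_Mapping.single (i + j)
      (Poly_Mapping.lookup p i * int_iterate \<sigma> i (Poly_Mapping.lookup q j)))"
    by (intro sum.mono_neutral_left) (use assms in \<open>auto simp: in_keys_iff\<close>)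
  finally show ?thesis .
qed

lemma skew_mult_add_left: "skew_mult \<sigma> (p + p') q = skew_mult \<sigma> p q + skew_mult \<sigma> p' q"
proof -
  let ?I = "Poly_Mapping.keys p \<union> Poly_Mapping.keys p'"
  have "Poly_Mapping.keys (p + p') \<subseteq> ?I" by (rule keys_add)
  then show ?thesis
    by (subst (1 2 3) skew_mult_superset[where I = ?I and J = "Poly_Mapping.keys q"])
      (auto simp: lookup_add distrib_right single_add sum.distrib)
qed

lemma skew_mult_add_right: "skew_mult \<sigma> p (q + q') = skew_mult \<sigma> p q + skew_mult \<sigma> p q'"
proof -
  let ?J = "Poly_Mapping.keys q \<union> Poly_Mapping.keys q'"
  have "Poly_Mapping.keys (q + q') \<subseteq> ?J" by (rule keys_add)
  then show ?thesis
    by (subst (1 2 3) skew_mult_superset[where J = ?J and I = "Poly_Mapping.keys p"])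
      (auto simp: lookup_add distrib_left single_add sum.distrib int_iterate_hom)
qed

lemma skew_mult_zero: "skew_mult \<sigma> 0 q = 0" "skew_mult \<sigma> p 0 = 0"
  by (simp_all add: skew_mult_def)

lemma skew_mult_single:
  "skew_mult \<sigma> (Poly_Mapping.single i a) (Poly_Mapping.single j b)
    = Poly_Mapping.single (i + j) (a * int_iterate \<sigma> i b)"
  by (subst skew_mult_superset[where I = "{i}" and J = "{j}"]) auto

lemma skew_commutation:
  "skew_mult \<sigma> (Poly_Mapping.single 1 1) (Poly_Mapping.single 0 r)
    = skew_mult \<sigma> (Poly_Mapping.single 0 (\<sigma> r)) (Poly_Mapping.single 1 1)"
  by (simp add: skew_mult_single int_iterate_def)

lemma laurent_induct [case_names zero add]:
  fixes p :: "int \<Rightarrow>\<^sub>0 'r"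
  assumes "P 0" and "\<And>p i a. P p \<Longrightarrow> P (p + Poly_Mapping.single i a)"
  shows "P p"
proof (induction p rule: update_induct)
  case const
  show ?case by (rule assms)
next
  case (update f a b)
  have "Poly_Mapping.update a b f = f + Poly_Mapping.single a b"
    by (rule poly_mapping_eqI)
      (use update in \<open>auto simp: lookup_update lookup_add lookup_single when_def in_keys_iff\<close>)
  with assms(2) update show ?case by metis
qed

lemma skew_mult_assoc:
  "skew_mult \<sigma> (skew_mult \<sigma> p q) r = skew_mult \<sigma> p (skew_mult \<sigma> q r)"
proof (induction p rule: laurent_induct)
  case zero
  show ?case by (simp add: skew_mult_zero)
next
  case (add p i a)
  have "skew_mult \<sigma> (skew_mult \<sigma> (Poly_Mapping.single i a) q) r
      = skew_mult \<sigma> (Poly_Mapping.single i a) (skew_mult \<sigma> q r)"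
  proof (induction q rule: laurent_induct)
    case zero
    show ?case by (simp add: skew_mult_zero)
  next
    case (add q j b)
    have "skew_mult \<sigma> (skew_mult \<sigma> (Poly_Mapping.single i a) (Poly_Mapping.single j b)) r
      = skew_mult \<sigma> (Poly_Mapping.single i a) (skew_mult \<sigma> (Poly_Mapping.single j b) r)"
    proof (induction r rule: laurent_induct)
      case zero
      show ?case by (simp add: skew_mult_zero)
    next
      case (add r l c)
      then show ?case
        by (simp add: skew_mult_add_right skew_mult_single int_iterate_hom int_iterate_add
            ac_simps)
    qed
    with add show ?case by (simp add: skew_mult_add_left skew_mult_add_right)
  qed
  with add show ?case by (simp add: skew_mult_add_left)
qed

lemma lookup_skew_scale:
  "Poly_Mapping.lookup (skew_scale scale c p) i = scale c (Poly_Mapping.lookup p i)"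
  by (simp add: skew_scale_def map.rep_eq when_def)

lemma skew_scale_add: "skew_scale scale c (p + q) = skew_scale scale c p + skew_scale scale c q"
  by (rule poly_mapping_eqI) (simp add: lookup_skew_scale lookup_add R.scale_right_distrib)

lemma skew_scale_zero: "skew_scale scale c 0 = 0"
  by (rule poly_mapping_eqI) (simp add: lookup_skew_scale)

lemma skew_scale_single:
  "skew_scale scale c (Poly_Mapping.single i a) = Poly_Mapping.single i (scale c a)"
  by (rule poly_mapping_eqI) (simp add: lookup_skew_scale lookup_single when_def)

lemma skew_mult_scale:
  "skew_mult \<sigma> (skew_scale scale c p) q = skew_scale scale c (skew_mult \<sigma> p q)"
  "skew_mult \<sigma> p (skew_scale scale c q) = skew_scale scale c (skew_mult \<sigma> p q)"
proof -
  have *: "skew_mult \<sigma> (skew_scale scale c p) q = skew_scale scale c (skew_mult \<sigma> p q) \<and>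
    skew_mult \<sigma> p (skew_scale scale c q) = skew_scale scale c (skew_mult \<sigma> p q)"
  proof (induction p rule: laurent_induct)
    case zero
    show ?case by (simp add: skew_mult_zero skew_scale_zero)
  next
    case (add p i a)
    have "skew_mult \<sigma> (skew_scale scale c (Poly_Mapping.single i a)) q
        = skew_scale scale c (skew_mult \<sigma> (Poly_Mapping.single i a) q) \<and>
      skew_mult \<sigma> (Poly_Mapping.single i a) (skew_scale scale c q)
        = skew_scale scale c (skew_mult \<sigma> (Poly_Mapping.single i a) q)"
      by (induction q rule: laurent_induct)
        (auto simp: skew_mult_zero skew_scale_zero skew_mult_add_right skew_scale_add
          skew_scale_single skew_mult_single int_iterate_hom R.mult_scale_left
          R.mult_scale_right)
    with add show ?case by (simp add: skew_mult_add_left skew_scale_add)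
  qed
  then show "skew_mult \<sigma> (skew_scale scale c p) q = skew_scale scale c (skew_mult \<sigma> p q)"
    "skew_mult \<sigma> p (skew_scale scale c q) = skew_scale scale c (skew_mult \<sigma> p q)" by auto
qed

lemma skew_mult_one: "skew_mult \<sigma> skew_one p = p" "skew_mult \<sigma> p skew_one = p"
proof -
  have "skew_mult \<sigma> skew_one p = p \<and> skew_mult \<sigma> p skew_one = p"
    by (induction p rule: laurent_induct)
      (simp_all add: skew_mult_zero skew_mult_add_left skew_mult_add_right skew_mult_single
        int_iterate_hom)
  then show "skew_mult \<sigma> skew_one p = p" "skew_mult \<sigma> p skew_one = p" by auto
qed

sublocale Q: k_algebra "skew_scale scale" "skew_mult \<sigma>" skew_one
proof unfold_locales
  fix a b :: 'k and x y :: "int \<Rightarrow>\<^sub>0 'r"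
  show "skew_scale scale a (x + y) = skew_scale scale a x + skew_scale scale a y"
    by (rule skew_scale_add)
  show "skew_scale scale (a + b) x = skew_scale scale a x + skew_scale scale b x"
    by (rule poly_mapping_eqI) (simp add: lookup_skew_scale lookup_add R.scale_left_distrib)
  show "skew_scale scale a (skew_scale scale b x) = skew_scale scale (a * b) x"
    by (rule poly_mapping_eqI) (simp add: lookup_skew_scale)
  show "skew_scale scale 1 x = x"
    by (rule poly_mapping_eqI) (simp add: lookup_skew_scale)
qed (simp_all add: skew_mult_assoc skew_mult_one skew_mult_add_left skew_mult_add_right
      skew_mult_scale)

text \<open>The set \<open>V\<^sub>n \<subseteq> R\<close> with \<open>A \<inter> Q\<^sub>n = V\<^sub>n t\<^sup>n\<close>.\<close>

definition graded_coeffs :: "(int \<Rightarrow>\<^sub>0 'r) set \<Rightarrow> nat \<Rightarrow> 'r set"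
  where "graded_coeffs A n = {r. Poly_Mapping.single (int n) r \<in> A}"

text \<open>\<open>A\<close> is a subalgebra with \<open>A = \<Oplus>\<^sub>n\<^sub>\<ge>\<^sub>0 V\<^sub>n t\<^sup>n\<close>, graded as a subset of \<open>Q\<close>.\<close>

definition N_graded_subalgebra :: "(int \<Rightarrow>\<^sub>0 'r) set \<Rightarrow> bool"
  where "N_graded_subalgebra A \<longleftrightarrow> Q.subalgebra A \<and>
    (\<forall>a\<in>A. \<forall>i\<in>Poly_Mapping.keys a.
      i \<ge> 0 \<and> Poly_Mapping.lookup a i \<in> graded_coeffs A (nat i))"

definition locally_finite :: "(int \<Rightarrow>\<^sub>0 'r) set \<Rightarrow> bool"
  where "locally_finite A \<longleftrightarrow> (\<forall>n. R.fd_subspace (graded_coeffs A n))"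

definition big_subalgebra :: "(int \<Rightarrow>\<^sub>0 'r) set \<Rightarrow> bool"
  where "big_subalgebra A \<longleftrightarrow> N_graded_subalgebra A \<and> locally_finite A \<and>
    (\<exists>n\<ge>1. \<exists>u\<in>graded_coeffs A n. \<exists>u'. u * u' = 1 \<and>
      (let B = R.subalgebra hull ((\<lambda>v. v * u') ` graded_coeffs A n) in
        \<exists>S. multiplicative_system S \<and> (\<forall>s\<in>S. nonzerodivisor_in B s) \<and> is_localization_of B S))"

end

end

theory Submission
  imports Defs "HOL-Library.Set_Algebras"
begin

text \<open>
  Write \<open>A = \<Oplus> V\<^sub>n t\<^sup>n\<close>, let \<open>u \<in> V\<^sub>n\<close> be the unit from the definition of a big subalgebra, and
  put \<open>V = V\<^sub>n u\<inverse>\<close>, which contains \<open>1\<close>.  Since \<open>R\<close> is commutative, the powers of \<open>V\<^sub>n t\<^sup>n\<close> in \<open>Q\<close>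
  are, up to a unit of \<open>R\<close> and a power of \<open>t\<close>, the products
  \<open>X\<^sub>K = V \<cdot> \<sigma>\<^sup>n(V) \<cdot> \<dots> \<cdot> \<sigma>\<^bsup>n(K-1)\<^esup>(V)\<close>, so that the growth of \<open>A\<close> bounds \<open>dim X\<^sub>K\<close>
  (\<open>dim_veronese_le\<close>).

  Let \<open>B\<close> be generated in degrees at most \<open>d\<close>, and let \<open>G\<close> be the union of the coefficient
  spaces of \<open>B\<close> in degrees \<open>0, \<dots>, d\<close>.  Multiplying out words in the generators shows that the
  coefficients of \<open>B\<close> in degree \<open>m \<ge> 1\<close> lie in the span of \<open>G \<cdot> \<sigma>(G) \<cdot> \<dots> \<cdot> \<sigma>\<^bsup>m-1\<^esup>(G)\<close>: a word moves
  from degree \<open>0\<close> to degree \<open>m\<close> in steps of length at most \<open>d\<close>, a step starting in degree \<open>j\<close>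
  contributes a factor from \<open>\<sigma>\<^sup>j(G)\<close>, and the degrees that are jumped over contribute \<open>1 \<in> G\<close>.
  Factors of degree \<open>0\<close> are absorbed by a neighbouring factor of positive degree, because
  \<open>B\<^sub>0 B\<^sub>i \<subseteq> B\<^sub>i\<close> and \<open>B\<^sub>i B\<^sub>0 \<subseteq> B\<^sub>i\<close> (\<open>coefficient_in_twisted_prod\<close>).

  As \<open>R\<close> is a localization of \<open>k[V]\<close>, and \<open>G\<close> spans a finite-dimensional space, the elements of
  \<open>G\<close> have a common denominator: \<open>s G\<close> is contained in the span of \<open>V\<^sup>p\<close> for a unit \<open>s\<close>
  and some \<open>p\<close>.  Multiplication by the unit \<open>s \<sigma>(s) \<dots> \<sigma>\<^bsup>K-1\<^esup>(s)\<close>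
  therefore embeds \<open>G \<cdot> \<sigma>(G) \<cdot> \<dots> \<cdot> \<sigma>\<^bsup>K-1\<^esup>(G)\<close> into the span of the same product for \<open>V\<^sup>p\<close>.  Sorting the
  exponents of \<open>\<sigma>\<close> by residue classes modulo \<open>n\<close>, this is contained in the product of \<open>p\<close> copies of
  \<open>X\<^sub>K \<cdot> \<sigma>(X\<^sub>K) \<cdot> \<dots> \<cdot> \<sigma>\<^bsup>n-1\<^esup>(X\<^sub>K)\<close>.  The dimension of a product of subspaces is at most the product
  of the dimensions, hence it is at most \<open>(dim X\<^sub>K)\<^bsup>np\<^esup>\<close> (\<open>dim_twisted_prod_le\<close>).

  Altogether a finite-dimensional \<open>W \<subseteq> B\<close> whose elements have degree at most \<open>c\<close> satisfies
  \<open>dim W\<^sup>N \<le> (cN + 1) (dim (V\<^sub>n t\<^sup>n)\<^bsup>cN\<^esup>)\<^bsup>np\<^esup>\<close> (\<open>growth_domination\<close>).  The exponent \<open>np\<close> does not depend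
  on \<open>N\<close> and \<open>W\<close>, so polynomial bounds remain polynomial, with an exponent common to all \<open>W\<close>, and
  subexponential bounds remain subexponential.
\<close>

section \<open>Dimensions of products of subspaces\<close>

text \<open>
  Products of subspaces are handled as products in the commutative monoid of all subsets of \<open>R\<close>,
  with spans taken at the end.  Keeping \<open>1\<close> instead of \<open>{1}\<close> for the unit of this monoid
  lets the simplification rules for monoids apply.
\<close>

declare set_one [simp del]

lemma (in vector_space_pair) dim_le_of_injective:
  assumes "Vector_Spaces.linear s1 s2 f" "inj f" "f ` A \<subseteq> vs2.span C" "finite F" "C \<subseteq> vs2.span F"
  shows "vs1.dim A \<le> vs2.dim C"
proof -
  obtain B where B: "B \<subseteq> A" "vs1.independent B" "card B = vs1.dim A"
    by (rule vs1.basis_exists)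
  obtain D where D: "finite D" "C \<subseteq> vs2.span D" "card D = vs2.dim C"
  proof -
    obtain D where D: "D \<subseteq> C" "vs2.independent D" "C \<subseteq> vs2.span D" "card D = vs2.dim C"
      by (rule vs2.basis_exists)
    moreover have "finite D"
      using vs2.independent_span_bound[OF assms(4) D(2)] D(1) assms(5) by blast
    ultimately show thesis using that by blast
  qed
  have "vs2.independent (f ` B)"
    by (rule linear_independent_injective_image) (use assms B in \<open>auto intro: inj_on_subset\<close>)
  moreover have "f ` B \<subseteq> vs2.span D"
    using assms(3) B(1) D(2) vs2.span_minimal[OF D(2) vs2.subspace_span] by blast
  ultimately have "card (f ` B) \<le> card D"
    using vs2.independent_span_bound[OF D(1)] by blast
  with B D show ?thesis using card_image[OF inj_on_subset[OF assms(2)], of B] by simp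
qed

context k_algebra
begin

definition finite_dim :: "'a set \<Rightarrow> bool"
  where "finite_dim A \<longleftrightarrow> (\<exists>F. finite F \<and> A \<subseteq> span F)"

lemma finite_dim_basis:
  assumes "finite_dim A"
  obtains B where "B \<subseteq> A" "finite B" "A \<subseteq> span B" "card B = dim A"
proof -
  obtain B where B: "B \<subseteq> A" "independent B" "A \<subseteq> span B" "card B = dim A"
    by (rule basis_exists)
  obtain F where "finite F" "A \<subseteq> span F" using assms by (auto simp: finite_dim_def)
  with B have "finite B" using independent_span_bound[of F B] by auto
  with B that show thesis by blast
qed

end

lemma (in k_algebra) mult_span:
  assumes "x \<in> span A" "y \<in> span B"
  shows "mult x y \<in> span ((\<lambda>(a, b). mult a b) ` (A \<times> B))"
proof -
  let ?M = "(\<lambda>(a, b). mult a b) ` (A \<times> B)"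
  have zero: "mult 0 z = 0" "mult z 0 = 0" for z
    using mult_add_left[of 0 0 z] mult_add_right[of z 0 0] by simp_all
  have base: "mult a b \<in> span ?M" if "a \<in> A" "b \<in> B" for a b
    by (rule span_base) (use that in \<open>auto intro!: image_eqI[of _ _ "(a, b)"]\<close>)
  have left: "mult a y \<in> span ?M" if "a \<in> A" for a
    using assms(2)
    by (induction rule: span_induct_alt)
      (simp_all add: mult_add_right mult_scale_right span_zero zero base span_add span_scale that)
  show ?thesis
    using assms(1)
    by (induction rule: span_induct_alt)
      (simp_all add: mult_add_left mult_scale_left span_zero zero left span_add span_scale)
qed

lemma (in k_algebra) finite_dim_space_power:
  assumes "finite_dim V"
  shows "finite_dim (space_power V n)"
proof -
  obtain E where E: "finite E" "V \<subseteq> span E" using assms by (auto simp: finite_dim_def)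
  let ?P = "\<lambda>n. {foldr mult es one | es. length es = n \<and> set es \<subseteq> E}"
  have "foldr mult xs one \<in> span (?P (length xs))" if "set xs \<subseteq> V" for xs
    using that
  proof (induction xs)
    case Nil
    show ?case by (rule span_base) auto
  next
    case (Cons x xs)
    then have "mult x (foldr mult xs one)
        \<in> span ((\<lambda>(a, b). mult a b) ` (E \<times> ?P (length xs)))"
      using E(2) by (intro mult_span) auto
    moreover have "(\<lambda>(a, b). mult a b) ` (E \<times> ?P (length xs)) \<subseteq> ?P (length (x # xs))"
    proof clarsimp
      fix a es assume "a \<in> E" "length es = length xs" "set es \<subseteq> E"
      then show "\<exists>es'. mult a (foldr mult es one) = foldr mult es' one
          \<and> length es' = Suc (length xs) \<and> set es' \<subseteq> E"
        by (intro exI[of _ "a # es"]) auto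
    qed
    ultimately have "mult x (foldr mult xs one) \<in> span (?P (length (x # xs)))"
      using span_mono by blast
    then show ?case by (simp only: foldr.simps comp_apply)
  qed
  then have "space_power V n \<subseteq> span (?P n)"
    unfolding space_power_def by (intro span_minimal) auto
  moreover have "?P n = (\<lambda>es. foldr mult es one) ` {es. set es \<subseteq> E \<and> length es = n}"
    by auto
  then have "finite (?P n)" using finite_lists_length_eq[OF E(1)] by simp
  ultimately show ?thesis unfolding finite_dim_def by blast
qed

lemma times_superset: "(1::'a::monoid_mult) \<in> B \<Longrightarrow> A \<subseteq> A * B"
  using set_times_intro[of _ A 1 B] by auto

lemma set_power_mono:
  fixes A :: "'a::comm_monoid_mult set"
  assumes "1 \<in> A" "p \<le> q"
  shows "A ^ p \<subseteq> A ^ q"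
proof -
  have "1 \<in> A ^ r" for r 
    by (induction r) (simp_all add: set_one set_times_intro[of 1 A 1, simplified] assms(1))
  with assms(2) show ?thesis using times_superset[of "A ^ (q - p)" "A ^ p"]
    by (simp flip: power_add)
qed

lemma set_prod_memI:
  "(\<And>i. i \<in> I \<Longrightarrow> f i \<in> F i) \<Longrightarrow> prod f I \<in> (\<Prod>i\<in>I. F i :: 'a::comm_monoid_mult set)"
  by (induction I rule: infinite_finite_induct) (simp_all add: set_one set_times_intro)

locale commutative_algebra = k_algebra scale "(*)" 1
  for scale :: "'k::field \<Rightarrow> 'r::{comm_ring,comm_monoid_mult} \<Rightarrow> 'r"
begin

lemma linear_times: "Vector_Spaces.linear scale scale ((*) c)"
  by unfold_locales (auto simp: mult_add_right mult_scale_right)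

lemma span_times: "span A * span B \<subseteq> span (A * B)"
  using mult_span by (auto simp: set_times_image split_def)

lemma times_span_mono:
  assumes "A \<subseteq> span A'" "B \<subseteq> span B'"
  shows "A * B \<subseteq> span (A' * B')"
  using set_times_mono2[OF assms] span_times by blast

lemma prod_span_mono:
  assumes "\<And>i. i \<in> I \<Longrightarrow> A i \<subseteq> span (B i)"
  shows "(\<Prod>i\<in>I. A i) \<subseteq> span (\<Prod>i\<in>I. B i)"
  using assms
proof (induction I rule: infinite_finite_induct)
  case (insert i I)
  then show ?case by (simp add: times_span_mono)
qed (auto intro: span_base)

lemma
  assumes "finite_dim A" "finite_dim B"
  shows finite_dim_times: "finite_dim (A * B)"
    and dim_times_le: "dim (A * B) \<le> dim A * dim B"
proof -
  obtain E where E: "finite E" "A \<subseteq> span E" "card E = dim A"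
    using finite_dim_basis[OF assms(1)] by metis
  obtain F where F: "finite F" "B \<subseteq> span F" "card F = dim B"
    using finite_dim_basis[OF assms(2)] by metis
  have *: "A * B \<subseteq> span (E * F)" "finite (E * F)"
    using times_span_mono[OF E(2) F(2)] finite_set_times[OF E(1) F(1)] by auto
  then show "finite_dim (A * B)" by (auto simp: finite_dim_def)
  have "dim (A * B) \<le> card (E * F)" by (rule dim_le_card[OF *])
  also have "\<dots> \<le> card E * card F"
    unfolding set_times_image using card_image_le[of "E \<times> F"] E(1) F(1)
    by (simp add: card_cartesian_product)
  finally show "dim (A * B) \<le> dim A * dim B" using E F by simp
qed

lemma
  assumes "\<And>i. i \<in> I \<Longrightarrow> finite_dim (A i)"
  shows finite_dim_prod: "finite_dim (\<Prod>i\<in>I. A i)"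
    and dim_prod_le: "dim (\<Prod>i\<in>I. A i) \<le> (\<Prod>i\<in>I. dim (A i))"
proof -
  have one: "finite_dim (1 :: 'r set)" "dim (1 :: 'r set) \<le> 1"
    using span_superset[of "{1}"] dim_le_card'[of "{1}"] by (auto simp: finite_dim_def set_one)
  have "finite_dim (\<Prod>i\<in>I. A i) \<and> dim (\<Prod>i\<in>I. A i) \<le> (\<Prod>i\<in>I. dim (A i))"
    using assms
  proof (induction I rule: infinite_finite_induct)
    case (insert i I)
    then show ?case
      using finite_dim_times[of "A i" "prod A I"] dim_times_le[of "A i" "prod A I"]
      by (auto intro: order_trans mult_le_mono2)
  qed (use one in auto)
  then show "finite_dim (\<Prod>i\<in>I. A i)" "dim (\<Prod>i\<in>I. A i) \<le> (\<Prod>i\<in>I. dim (A i))" by auto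
qed

text \<open>
  Because \<open>1 \<in> V\<close>, the powers of \<open>V\<close> increase, so the union of their spans is closed under addition.
\<close>

lemma generated_subalgebra_subset:
  assumes "1 \<in> V"
  shows "subalgebra hull V \<subseteq> (\<Union>p. span (V ^ p))"
proof (rule hull_minimal)
  show "V \<subseteq> (\<Union>p. span (V ^ p))"
  proof
    fix v assume "v \<in> V"
    then have "v \<in> span (V ^ 1)" by (simp add: span_base)
    then show "v \<in> (\<Union>p. span (V ^ p))" by blast
  qed
  have *: "\<exists>p. x \<in> span (V ^ p) \<and> y \<in> span (V ^ p)"
    if "x \<in> span (V ^ p)" "y \<in> span (V ^ q)" for x y p q
  proof -
    have "span (V ^ p) \<subseteq> span (V ^ max p q)" "span (V ^ q) \<subseteq> span (V ^ max p q)"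
      by (simp_all add: span_mono set_power_mono assms)
    with that show ?thesis by blast
  qed
  show "subalgebra (\<Union>p. span (V ^ p))"
    unfolding subalgebra_def
  proof (intro conjI ballI)
    have "1 \<in> span (V ^ 0)" by (simp add: span_base set_one)
    then show "1 \<in> (\<Union>p. span (V ^ p))" by blast
    show "x * y \<in> (\<Union>p. span (V ^ p))"
      if "x \<in> (\<Union>p. span (V ^ p))" "y \<in> (\<Union>p. span (V ^ p))" for x y
    proof -
      from that obtain p q where "x \<in> span (V ^ p)" "y \<in> span (V ^ q)" by blast
      then have "x * y \<in> span (V ^ (p + q))"
        unfolding power_add using span_times by blast
      then show ?thesis by blast
    qed
    show "subspace (\<Union>p. span (V ^ p))"
      unfolding subspace_def
    proof (intro conjI ballI allI)
      show "0 \<in> (\<Union>p. span (V ^ p))" by (auto simp: span_zero)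
      show "x + y \<in> (\<Union>p. span (V ^ p))"
        if "x \<in> (\<Union>p. span (V ^ p))" "y \<in> (\<Union>p. span (V ^ p))" for x y
      proof -
        from that obtain p q where "x \<in> span (V ^ p)" "y \<in> span (V ^ q)" by blast
        from *[OF this] obtain r where "x \<in> span (V ^ r)" "y \<in> span (V ^ r)" by blast
        then have "x + y \<in> span (V ^ r)" by (rule span_add)
        then show ?thesis by blast
      qed
      show "scale c x \<in> (\<Union>p. span (V ^ p))" if "x \<in> (\<Union>p. span (V ^ p))" for c x
        using that by (auto intro: span_scale)
    qed
  qed
qed

lemma finite_subset_generated_subalgebra:
  assumes "1 \<in> V" "finite E" "E \<subseteq> subalgebra hull V"
  obtains p where "E \<subseteq> span (V ^ p)"
proof -
  have "\<forall>e\<in>E. \<exists>p. e \<in> span (V ^ p)"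
    using assms(3) generated_subalgebra_subset[OF assms(1)] by blast
  then obtain f where f: "\<And>e. e \<in> E \<Longrightarrow> e \<in> span (V ^ f e)" by metis
  have "e \<in> span (V ^ Max (f ` E))" if "e \<in> E" for e
  proof -
    have "f e \<le> Max (f ` E)" using assms(2) that by simp
    then show ?thesis using f[OF that] span_mono[OF set_power_mono[OF assms(1)]] by blast
  qed
  then show thesis using that by blast
qed

lemma subalgebra_hull: "subalgebra (subalgebra hull X)"
proof (rule hull_in)
  fix T assume "\<forall>A\<in>T. subalgebra A"
  then show "subalgebra (\<Inter>T)"
    by (auto simp: subalgebra_def subspace_def)
qed

text \<open>
  The product of the denominators of the finitely many elements; it stays in \<open>S \<subseteq> B\<close>, so
  multiplying by the superfluous factors does not leave \<open>B\<close>.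
\<close>

lemma common_denominator:
  assumes "subalgebra B" "multiplicative_system S" "S \<subseteq> B" "is_localization_of B S" "finite E"
  obtains s where "s \<in> S" "s dvd 1" "\<And>e. e \<in> E \<Longrightarrow> e * s \<in> B"
proof -
  have "\<exists>s\<in>S. \<forall>e\<in>E. e * s \<in> B" using assms(5)
  proof induction
    case empty
    then show ?case using assms(2) by (auto simp: multiplicative_system_def)
  next
    case (insert e E)
    then obtain s where s: "s \<in> S" "\<forall>e\<in>E. e * s \<in> B" by blast
    obtain s' where s': "s' \<in> S" "e * s' \<in> B"
      using assms(4) unfolding is_localization_of_def by metis
    have "s * s' \<in> S" using s(1) s'(1) assms(2) by (auto simp: multiplicative_system_def)
    moreover have "e' * (s * s') \<in> B" if "e' \<in> insert e E" for e'
    proof (cases "e' = e")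
      case True
      have "s * (e * s') \<in> B"
        using s(1) s'(2) assms(1,3) by (auto simp: subalgebra_def)
      with True show ?thesis by (simp add: ac_simps)
    next
      case False
      then have "(e' * s) * s' \<in> B"
        using s(2) s'(1) that assms(1,3) unfolding subalgebra_def by blast
      then show ?thesis by (simp add: ac_simps)
    qed
    ultimately show ?case by blast
  qed
  with that assms(4) show thesis by (auto simp: is_localization_of_def)
qed

end

section \<open>Twisted products\<close>

sublocale skew_laurent \<subseteq> R: commutative_algebra scale ..

context skew_laurent
begin

lemma int_iterate_int: "int_iterate \<sigma> (int j) = \<sigma> ^^ j"
  by (simp add: int_iterate_def fun_eq_iff)

lemmas funpow_hom = int_iterate_hom[of "int j" for j, unfolded int_iterate_int]

lemma linear_funpow: "Vector_Spaces.linear scale scale (\<sigma> ^^ j)"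
  by unfold_locales (simp_all add: funpow_hom)

lemma funpow_image_span: "(\<sigma> ^^ j) ` R.span A = R.span ((\<sigma> ^^ j) ` A)"
proof -
  interpret f: Vector_Spaces.linear scale scale "\<sigma> ^^ j" by (rule linear_funpow)
  show ?thesis by (simp add: f.span_image)
qed

lemma funpow_image_times: "(\<sigma> ^^ j) ` (A * B) = (\<sigma> ^^ j) ` A * (\<sigma> ^^ j) ` B"
proof -
  have "(\<sigma> ^^ j) ` (A * B) = (\<lambda>(x, y). (\<sigma> ^^ j) x * (\<sigma> ^^ j) y) ` (A \<times> B)"
    by (simp add: set_times_image image_image split_def funpow_hom)
  also have "\<dots> = (\<lambda>(x, y). x * y) ` map_prod (\<sigma> ^^ j) (\<sigma> ^^ j) ` (A \<times> B)"
    by (simp add: image_image split_def)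
  also have "\<dots> = (\<sigma> ^^ j) ` A * (\<sigma> ^^ j) ` B"
    by (simp add: set_times_image map_prod_surj_on[OF refl refl])
  finally show ?thesis .
qed

lemma image_one: "(\<sigma> ^^ j) ` 1 = 1"
  by (simp add: set_one funpow_hom)

lemma funpow_image_prod: "(\<sigma> ^^ j) ` (\<Prod>i\<in>I. F i) = (\<Prod>i\<in>I. (\<sigma> ^^ j) ` F i)"
  by (induction I rule: infinite_finite_induct) (simp_all add: funpow_image_times image_one)

lemma funpow_unit: "u dvd 1 \<Longrightarrow> (\<sigma> ^^ j) u dvd 1"
proof (elim dvdE)
  fix v assume "1 = u * v"
  then have "1 = (\<sigma> ^^ j) u * (\<sigma> ^^ j) v" by (metis funpow_hom(2,3))
  then show ?thesis by (rule dvdI)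
qed

lemma prod_unit: "(\<And>i. i \<in> I \<Longrightarrow> f i dvd (1::'r)) \<Longrightarrow> prod f I dvd 1"
  by (induction I rule: infinite_finite_induct) (use mult_dvd_mono[of _ "1 :: 'r" _ 1] in simp_all)

lemma inj_times_unit: "w dvd (1::'r) \<Longrightarrow> inj ((*) w)"
proof (elim dvdE, rule injI)
  fix v x y assume v: "1 = w * v" and "w * x = w * y"
  then have "(v * w) * x = (v * w) * y" by (simp only: mult.assoc)
  with v show "x = y" by (simp add: mult.commute[of v w] flip: v)
qed

lemma finite_dim_funpow_image:
  assumes "R.finite_dim A"
  shows "R.finite_dim ((\<sigma> ^^ j) ` A)" and "R.dim ((\<sigma> ^^ j) ` A) \<le> R.dim A"
proof -
  obtain E where E: "finite E" "A \<subseteq> R.span E" "card E = R.dim A"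
    using R.finite_dim_basis[OF assms] by metis
  have sub: "(\<sigma> ^^ j) ` A \<subseteq> R.span ((\<sigma> ^^ j) ` E)"
    unfolding funpow_image_span[symmetric] by (rule image_mono[OF E(2)])
  then show "R.finite_dim ((\<sigma> ^^ j) ` A)"
    using E(1) unfolding R.finite_dim_def by blast
  show "R.dim ((\<sigma> ^^ j) ` A) \<le> R.dim A"
    using R.dim_le_card[OF sub] E(1,3) card_image_le[OF E(1), of "\<sigma> ^^ j"] by simp
qed

text \<open>
  The coefficients of the products of \<open>m\<close> elements of \<open>Gt\<close>.
\<close>

definition twisted_prod :: "'r set \<Rightarrow> nat \<Rightarrow> 'r set"
  where "twisted_prod G m = (\<Prod>j<m. (\<sigma> ^^ j) ` G)"

lemma twisted_prod_add:
  "twisted_prod G (i + j) = twisted_prod G i * (\<sigma> ^^ i) ` twisted_prod G j"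
proof (induction j)
  case 0
  then show ?case by (simp add: twisted_prod_def image_one)
next
  case (Suc j)
  then show ?case
    by (simp add: twisted_prod_def funpow_image_times funpow_add image_comp mult.assoc)
qed

lemma one_in_twisted_prod: "1 \<in> G \<Longrightarrow> 1 \<in> twisted_prod G m"
  using set_prod_memI[of "{..<m}" "\<lambda>_. 1" "\<lambda>j. (\<sigma> ^^ j) ` G"]
  by (force simp: twisted_prod_def image_iff funpow_hom)

lemma twisted_prod_mono:
  assumes "1 \<in> G" "m \<le> m'"
  shows "twisted_prod G m \<subseteq> twisted_prod G m'"
proof -
  have "1 \<in> (\<sigma> ^^ m) ` twisted_prod G (m' - m)"
    using one_in_twisted_prod[OF assms(1)] by (force simp: image_iff funpow_hom)
  then show ?thesis
    using times_superset assms(2) twisted_prod_add[of G m "m' - m"] by simp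
qed

lemma twisted_prod_power: "twisted_prod (V ^ p) m = twisted_prod V m ^ p"
  by (induction p)
    (simp_all add: twisted_prod_def funpow_image_times prod.distrib image_one)

lemma twisted_prod_residue_classes:
  "twisted_prod V (K * n) = (\<Prod>r<n. (\<sigma> ^^ r) ` (\<Prod>q<K. (\<sigma> ^^ (q * n)) ` V))"
proof -
  have "twisted_prod V (K * n) = (\<Prod>q<K. \<Prod>m\<in>{q * n..<q * n + n}. (\<sigma> ^^ m) ` V)"
    by (simp add: twisted_prod_def prod.nat_group)
  also have "\<dots> = (\<Prod>q<K. \<Prod>r<n. (\<sigma> ^^ (r + q * n)) ` V)"
  proof (rule prod.cong[OF refl])
    fix q
    show "(\<Prod>m\<in>{q * n..<q * n + n}. (\<sigma> ^^ m) ` V) = (\<Prod>r<n. (\<sigma> ^^ (r + q * n)) ` V)"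
      using prod.shift_bounds_nat_ivl[of "\<lambda>m. (\<sigma> ^^ m) ` V" 0 "q * n" n]
      by (simp add: add.commute lessThan_atLeast0)
  qed
  also have "\<dots> = (\<Prod>r<n. \<Prod>q<K. (\<sigma> ^^ (r + q * n)) ` V)"
    by (rule prod.swap)
  finally show ?thesis by (simp add: funpow_image_prod funpow_add image_comp)
qed

lemma finite_dim_twisted_prod: "R.finite_dim G \<Longrightarrow> R.finite_dim (twisted_prod G m)"
  unfolding twisted_prod_def by (intro R.finite_dim_prod finite_dim_funpow_image)

text \<open>
  The exponent on the right arises from \<open>n\<close> residue classes and \<open>p\<close> factors in \<open>V\<^sup>p\<close>.  It is crude but
  independent of \<open>K\<close>, which is all that is needed to compare growth.  Padding \<open>K\<close> factors to
  \<open>K n\<close> with \<open>1 \<in> V\<^sup>p\<close> makes all residue classes have the same length.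
\<close>

lemma dim_twisted_prod_le:
  assumes V: "1 \<in> V" "R.finite_dim V" and "n \<ge> 1"
    and s: "s dvd 1" "\<And>g. g \<in> G \<Longrightarrow> s * g \<in> R.span (V ^ p)"
  shows "R.dim (twisted_prod G K) \<le> R.dim (\<Prod>q<K. (\<sigma> ^^ (q * n)) ` V) ^ (n * p)"
proof -
  define X where "X = (\<Prod>q<K. (\<sigma> ^^ (q * n)) ` V)"
  define Y where "Y = (\<Prod>i<p. \<Prod>r<n. (\<sigma> ^^ r) ` X)"
  define w where "w = (\<Prod>j<K. (\<sigma> ^^ j) s)"
  interpret vector_space_pair scale scale ..
  have X: "R.finite_dim X"
    unfolding X_def by (intro R.finite_dim_prod finite_dim_funpow_image V)
  then have Y: "R.finite_dim Y"
    unfolding Y_def by (intro R.finite_dim_prod finite_dim_funpow_image)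
  have "1 \<in> V ^ p" using set_power_mono[OF V(1), of 0 p] by (simp add: set_one)
  then have "twisted_prod (V ^ p) K \<subseteq> twisted_prod (V ^ p) (K * n)"
    using \<open>n \<ge> 1\<close> by (intro twisted_prod_mono) auto
  also have "\<dots> = Y"
    unfolding twisted_prod_power X_def Y_def by (simp add: twisted_prod_residue_classes)
  finally have sub_Y: "twisted_prod (V ^ p) K \<subseteq> Y" .
  have "(*) w ` twisted_prod G K \<subseteq> R.span (twisted_prod (V ^ p) K)"
  proof -
    have "w \<in> (\<Prod>j<K. {(\<sigma> ^^ j) s})"
      unfolding w_def by (rule set_prod_memI) simp
    then have "(*) w ` twisted_prod G K \<subseteq> (\<Prod>j<K. {(\<sigma> ^^ j) s}) * twisted_prod G K"
      by (auto intro: set_times_intro)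
    also have "\<dots> = (\<Prod>j<K. (\<sigma> ^^ j) ` ({s} * G))"
      by (simp add: twisted_prod_def prod.distrib funpow_image_times)
    also have "\<dots> \<subseteq> R.span (\<Prod>j<K. (\<sigma> ^^ j) ` (V ^ p))"
    proof (rule R.prod_span_mono)
      fix j
      have "{s} * G \<subseteq> R.span (V ^ p)" using s(2) by (auto elim!: set_times_elim)
      then show "(\<sigma> ^^ j) ` ({s} * G) \<subseteq> R.span ((\<sigma> ^^ j) ` (V ^ p))"
        unfolding funpow_image_span[symmetric] by (rule image_mono)
    qed
    finally show ?thesis by (simp add: twisted_prod_def)
  qed
  then have "(*) w ` twisted_prod G K \<subseteq> R.span Y"
    using R.span_mono[OF sub_Y] by blast
  moreover have "inj ((*) w)"
    unfolding w_def by (intro inj_times_unit prod_unit funpow_unit s)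
  moreover obtain F where "finite F" "Y \<subseteq> R.span F"
    using Y by (auto simp: R.finite_dim_def)
  ultimately have "R.dim (twisted_prod G K) \<le> R.dim Y"
    using R.linear_times by (intro dim_le_of_injective)
  also have "\<dots> \<le> (\<Prod>i<p. \<Prod>r<n. R.dim ((\<sigma> ^^ r) ` X))"
    unfolding Y_def
    by (rule order_trans[OF R.dim_prod_le prod_mono])
      (auto intro!: R.finite_dim_prod R.dim_prod_le finite_dim_funpow_image X)
  also have "\<dots> \<le> (\<Prod>i<p. \<Prod>r<n. R.dim X)"
    by (intro prod_mono conjI finite_dim_funpow_image X prod_nonneg) auto
  also have "\<dots> = R.dim X ^ (n * p)" by (simp add: power_mult)
  finally show "R.dim (twisted_prod G K) \<le> R.dim X ^ (n * p)" .
qed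

lemma linear_single: "Vector_Spaces.linear scale (skew_scale scale) (Poly_Mapping.single i)"
  by unfold_locales (simp_all add: single_add skew_scale_single)

text \<open>
  The map \<open>x \<mapsto> u \<sigma>\<^sup>n(u) \<dots> \<sigma>\<^bsup>n(K-1)\<^esup>(u) x t\<^bsup>nK\<^esup>\<close> is injective, as \<open>u\<close> is a unit, and takes the twisted
  product on the left into the \<open>K\<close>-th power of \<open>U t\<^sup>n\<close>.
\<close>

lemma dim_veronese_le:
  assumes u: "u * u' = 1" and U: "R.finite_dim U"
  shows "R.dim (\<Prod>q<K. (\<sigma> ^^ (q * n)) ` (\<lambda>v. v * u') ` U)
    \<le> Q.dim (Q.space_power (Poly_Mapping.single (int n) ` U) K)"
proof -
  define V where "V = (\<lambda>v. v * u') ` U"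
  define X where "X K = (\<Prod>q<K. (\<sigma> ^^ (q * n)) ` V)" for K
  define w where "w K = (\<Prod>q<K. (\<sigma> ^^ (q * n)) u)" for K
  define P where "P K = {foldr (skew_mult \<sigma>) xs skew_one | xs.
    length xs = K \<and> set xs \<subseteq> Poly_Mapping.single (int n) ` U}" for K
  have X_Suc: "X (Suc K) = V * (\<sigma> ^^ n) ` X K" for K
    unfolding X_def prod.lessThan_Suc_shift
    by (simp add: funpow_image_prod funpow_add image_comp)
  have prod_hom: "(\<sigma> ^^ n) (prod f I) = (\<Prod>i\<in>I. (\<sigma> ^^ n) (f i))" for f :: "nat \<Rightarrow> 'r" and I
    by (induction I rule: infinite_finite_induct) (simp_all add: funpow_hom)
  have w_Suc: "w (Suc K) = u * (\<sigma> ^^ n) (w K)" for K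
    unfolding w_def prod.lessThan_Suc_shift by (simp add: prod_hom funpow_add)
  have "Poly_Mapping.single (int (n * K)) (w K * x) \<in> P K" if "x \<in> X K" for x K
    using that
  proof (induction K arbitrary: x)
    case 0
    then show ?case by (simp add: X_def w_def P_def set_one)
  next
    case (Suc K)
    then obtain a y where a: "a \<in> U" and y: "y \<in> X K" and x: "x = (a * u') * (\<sigma> ^^ n) y"
      unfolding X_Suc V_def by (auto elim!: set_times_elim)
    from Suc.IH[OF y] obtain ys where ys: "length ys = K"
      "set ys \<subseteq> Poly_Mapping.single (int n) ` U"
      "Poly_Mapping.single (int (n * K)) (w K * y) = foldr (skew_mult \<sigma>) ys skew_one"
      by (auto simp: P_def)
    have "w (Suc K) * x = (u * u') * (a * (\<sigma> ^^ n) (w K * y))"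
      by (simp add: w_Suc x funpow_hom ac_simps)
    then have "Poly_Mapping.single (int (n * Suc K)) (w (Suc K) * x)
        = skew_mult \<sigma> (Poly_Mapping.single (int n) a)
            (Poly_Mapping.single (int (n * K)) (w K * y))"
      by (simp add: skew_mult_single int_iterate_int u)
    then show ?case
      unfolding P_def using a ys
      by (intro CollectI exI[of _ "Poly_Mapping.single (int n) a # ys"]) auto
  qed
  then have image: "(Poly_Mapping.single (int (n * K)) \<circ> (*) (w K)) ` X K
      \<subseteq> Q.span (Q.space_power (Poly_Mapping.single (int n) ` U) K)"
    unfolding Q.space_power_def Q.span_span using Q.span_superset
    by (fastforce simp: P_def)
  have "u dvd 1" using u by (metis dvdI)
  then have "inj ((*) (w K))"
    unfolding w_def by (intro inj_times_unit prod_unit funpow_unit)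
  then have inj: "inj (Poly_Mapping.single (int (n * K)) \<circ> (*) (w K))"
    by (intro inj_compose) (auto intro: injI dest: arg_cong[of _ _ "\<lambda>p. Poly_Mapping.lookup p _"])
  interpret vector_space_pair scale "skew_scale scale" ..
  obtain E where E: "finite E" "U \<subseteq> R.span E" using U by (auto simp: R.finite_dim_def)
  interpret single: Vector_Spaces.linear scale "skew_scale scale" "Poly_Mapping.single (int n)"
    by (rule linear_single)
  have "Poly_Mapping.single (int n) ` U \<subseteq> Q.span (Poly_Mapping.single (int n) ` E)"
    unfolding single.span_image using E(2) by (rule image_mono)
  then have "Q.finite_dim (Poly_Mapping.single (int n) ` U)"
    using E(1) unfolding Q.finite_dim_def by blast
  then have "Q.finite_dim (Q.space_power (Poly_Mapping.single (int n) ` U) K)"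
    by (rule Q.finite_dim_space_power)
  then obtain F where "finite F" "Q.space_power (Poly_Mapping.single (int n) ` U) K \<subseteq> Q.span F"
    by (auto simp: Q.finite_dim_def)
  with image inj show ?thesis
    using Vector_Spaces.linear_compose[OF R.linear_times linear_single]
    unfolding X_def V_def by (intro dim_le_of_injective)
qed

section \<open>Coefficients of a finitely generated graded subalgebra\<close>

lemma lookup_skew_mult_mem:
  assumes "R.subspace S"
    and "\<And>i j. i \<in> Poly_Mapping.keys p \<Longrightarrow> j \<in> Poly_Mapping.keys q \<Longrightarrow> i + j = m \<Longrightarrow>
      Poly_Mapping.lookup p i * int_iterate \<sigma> i (Poly_Mapping.lookup q j) \<in> S"
  shows "Poly_Mapping.lookup (skew_mult \<sigma> p q) m \<in> S"
  unfolding skew_mult_def lookup_sum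
  by (intro R.subspace_sum[OF assms(1)])
    (auto simp: lookup_single when_def assms R.subspace_0)

lemma graded_coeffs_mult:
  assumes "Q.subalgebra B" "a \<in> graded_coeffs B i" "b \<in> graded_coeffs B j"
  shows "a * (\<sigma> ^^ i) b \<in> graded_coeffs B (i + j)"
proof -
  have "skew_mult \<sigma> (Poly_Mapping.single (int i) a) (Poly_Mapping.single (int j) b) \<in> B"
    using assms unfolding Q.subalgebra_def graded_coeffs_def by blast
  then show ?thesis by (simp add: graded_coeffs_def skew_mult_single int_iterate_int)
qed

lemma N_gradedD:
  assumes "N_graded_subalgebra B" "b \<in> B" "i \<in> Poly_Mapping.keys b"
  shows "i \<ge> 0" "Poly_Mapping.lookup b i \<in> graded_coeffs B (nat i)"
  using assms unfolding N_graded_subalgebra_def by auto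

text \<open>
  The obstacle is that a product of coefficients of degrees \<open>i\<close> and \<open>0\<close> belongs to a twisted product
  of \<open>i + 1\<close> rather than \<open>i\<close> factors, so the elements with the claimed property are not evidently
  closed under multiplication.  They are closed under left multiplication by generators, though:
  a generator has degree \<open>i \<le> d\<close>, and its product with an element of degree \<open>0\<close> is again of degree
  \<open>i \<le> d\<close> and has its coefficient in \<open>G\<close>.  The proof therefore works with the subalgebra of left
  multipliers.
\<close>

lemma coefficient_in_twisted_prod:
  assumes B: "N_graded_subalgebra B" and gen: "B = Q.subalgebra hull X"
    and deg: "\<And>x i. x \<in> X \<Longrightarrow> i \<in> Poly_Mapping.keys x \<Longrightarrow> i \<le> int d"
    and "b \<in> B" "m \<ge> 1"
  defines "G \<equiv> \<Union>i\<le>d. graded_coeffs B i"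
  shows "Poly_Mapping.lookup b (int m) \<in> R.span (twisted_prod G m)"
proof -
  define T where "T = {b \<in> B. \<forall>m\<ge>1. Poly_Mapping.lookup b (int m) \<in> R.span (twisted_prod G m)}"
  define L where "L = {x \<in> B. \<forall>y\<in>T. skew_mult \<sigma> x y \<in> T}"
  have sub: "Q.subalgebra B" using B by (simp add: N_graded_subalgebra_def)
  have T_subspace: "Q.subspace T"
    using sub unfolding Q.subspace_def T_def Q.subalgebra_def
    by (auto simp: lookup_add lookup_skew_scale R.span_zero intro: R.span_add R.span_scale)
  have one_B: "skew_one \<in> B" using sub by (simp add: Q.subalgebra_def)
  then have one_T: "skew_one \<in> T"
    by (auto simp: T_def lookup_single R.span_zero)
  have one_G: "1 \<in> G"
    using one_B by (auto simp: G_def graded_coeffs_def intro!: bexI[of _ 0])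
  have L_subalgebra: "Q.subalgebra L"
    unfolding Q.subalgebra_def
  proof (intro conjI ballI)
    show "Q.subspace L"
      using sub T_subspace unfolding L_def Q.subalgebra_def Q.subspace_def
      by (auto simp: skew_mult_zero skew_mult_add_left skew_mult_scale)
    show "skew_one \<in> L" using one_B by (simp add: L_def skew_mult_one)
    show "skew_mult \<sigma> x y \<in> L" if "x \<in> L" "y \<in> L" for x y
      using that sub unfolding L_def Q.subalgebra_def by (auto simp: skew_mult_assoc)
  qed
  have G_twisted: "G \<subseteq> R.span (twisted_prod G i)" if "i \<ge> 1" for i
  proof -
    have "G = twisted_prod G 1" by (simp add: twisted_prod_def)
    also have "\<dots> \<subseteq> twisted_prod G i" by (rule twisted_prod_mono[OF one_G that])
    finally show ?thesis using R.span_superset by blast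
  qed
  \<comment> \<open>It is enough that \<open>L\<close> contains the generators: then \<open>B T \<subseteq> T\<close>, and \<open>B = B \<cdot> 1 \<subseteq> T\<close>.\<close>
  have "X \<subseteq> L"
  proof
    fix x assume x: "x \<in> X"
    have "X \<subseteq> B" unfolding gen by (rule hull_subset)
    with x have xB: "x \<in> B" by blast
    have xG: "Poly_Mapping.lookup x (int i) \<in> graded_coeffs B i" "i \<le> d"
      if "int i \<in> Poly_Mapping.keys x" for i
      using N_gradedD(2)[OF B xB that] deg[OF x that] by auto
    have "skew_mult \<sigma> x y \<in> T" if y: "y \<in> T" for y
    proof -
      have yB: "y \<in> B" using y by (simp add: T_def)
      have "Poly_Mapping.lookup (skew_mult \<sigma> x y) (int m) \<in> R.span (twisted_prod G m)"
        if m: "m \<ge> 1" for m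
      proof (rule lookup_skew_mult_mem[OF R.subspace_span])
        fix i' j' assume keys: "i' \<in> Poly_Mapping.keys x" "j' \<in> Poly_Mapping.keys y"
          and sum: "i' + j' = int m"
        obtain i j where ij: "i' = int i" "j' = int j"
          using N_gradedD(1)[OF B xB keys(1)] N_gradedD(1)[OF B yB keys(2)]
          by (metis nonneg_int_cases)
        with sum have m_eq: "m = i + j" by simp
        note xi = xG[OF keys(1)[unfolded ij]]
        then have xi_G: "Poly_Mapping.lookup x (int i) \<in> G" by (auto simp: G_def)
        show "Poly_Mapping.lookup x i' * int_iterate \<sigma> i' (Poly_Mapping.lookup y j')
            \<in> R.span (twisted_prod G m)"
        proof (cases "i = 0 \<or> j = 0")
          case False
          then have "(\<sigma> ^^ i) (Poly_Mapping.lookup y (int j))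
              \<in> R.span ((\<sigma> ^^ i) ` twisted_prod G j)"
            using y unfolding T_def funpow_image_span[symmetric] by simp
          moreover have "Poly_Mapping.lookup x (int i) \<in> R.span (twisted_prod G i)"
            using G_twisted[of i] xi_G False by auto
          ultimately have "Poly_Mapping.lookup x (int i) * (\<sigma> ^^ i) (Poly_Mapping.lookup y (int j))
              \<in> R.span (twisted_prod G i * (\<sigma> ^^ i) ` twisted_prod G j)"
            using R.span_times by blast
          then show ?thesis by (simp add: ij m_eq twisted_prod_add int_iterate_int)
        next
          case True
          then consider "i = 0" | "i \<ge> 1" "j = 0" by linarith
          then show ?thesis
          proof cases
            case 1
            let ?c = "Poly_Mapping.lookup x 0"
            have c: "?c \<in> graded_coeffs B 0" using xi(1) 1 by simp
            \<comment> \<open>\<open>B\<^sub>0 B\<^sub>i \<subseteq> B\<^sub>i\<close>, so the extra factor is absorbed by the leftmost copy of \<open>G\<close>.\<close>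
            have "{?c} * G \<subseteq> G"
              unfolding G_def using graded_coeffs_mult[OF sub c] by (force elim: set_times_elim)
            moreover have split: "twisted_prod G m = G * \<sigma> ` twisted_prod G (m - 1)"
              using m twisted_prod_add[of G 1 "m - 1"] by (simp add: twisted_prod_def[of G "Suc 0"])
            ultimately have "{?c} * twisted_prod G m \<subseteq> twisted_prod G m"
              unfolding split mult.assoc[symmetric] by (intro set_times_mono2 order_refl)
            moreover have "Poly_Mapping.lookup y (int j) \<in> R.span (twisted_prod G m)"
              using y m m_eq 1 by (simp add: T_def)
            then have "?c * Poly_Mapping.lookup y (int j) \<in> R.span ({?c} * twisted_prod G m)"
              using R.times_span_mono[of "{?c}" "{?c}" "R.span (twisted_prod G m)"
                  "twisted_prod G m"] by (auto intro: R.span_base)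
            ultimately show ?thesis
              using R.span_mono by (auto simp: ij 1)
          next
            case 2
            \<comment> \<open>\<open>B\<^sub>i B\<^sub>0 \<subseteq> B\<^sub>i\<close>, and \<open>i \<le> d\<close>.\<close>
            have "Poly_Mapping.lookup y 0 \<in> graded_coeffs B 0"
              using N_gradedD(2)[OF B yB keys(2)] ij 2 by simp
            from graded_coeffs_mult[OF sub xi(1) this]
            have "Poly_Mapping.lookup x (int i) * (\<sigma> ^^ i) (Poly_Mapping.lookup y 0) \<in> G"
              using xi(2) by (auto simp: G_def)
            then show ?thesis
              using G_twisted[OF 2(1)] 2 by (auto simp: ij m_eq int_iterate_int)
          qed
        qed
      qed
      moreover have "skew_mult \<sigma> x y \<in> B"
        using sub xB yB by (auto simp: Q.subalgebra_def)
      ultimately show ?thesis by (simp add: T_def)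
    qed
    with xB show "x \<in> L" by (simp add: L_def)
  qed
  then have "B \<subseteq> L"
    unfolding gen by (rule hull_minimal) (rule L_subalgebra)
  with \<open>b \<in> B\<close> have "skew_mult \<sigma> b skew_one \<in> T"
    using one_T by (auto simp: L_def)
  with \<open>m \<ge> 1\<close> show ?thesis by (simp add: skew_mult_one T_def)
qed

lemma laurent_expansion:
  "p = (\<Sum>i\<in>Poly_Mapping.keys p. Poly_Mapping.single i (Poly_Mapping.lookup p i))"
  by (rule poly_mapping_eqI)
    (auto simp: lookup_sum lookup_single when_def sum.delta in_keys_iff)

lemma dim_bounded_degree_le:
  assumes S: "\<And>q i. q \<in> S \<Longrightarrow> i \<in> Poly_Mapping.keys q \<Longrightarrow>
      0 \<le> i \<and> i \<le> int K \<and> Poly_Mapping.lookup q i \<in> R.span P"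
    and P: "R.finite_dim P"
  shows "Q.dim S \<le> (K + 1) * R.dim P"
proof -
  obtain D where D: "finite D" "P \<subseteq> R.span D" "card D = R.dim P"
    using R.finite_dim_basis[OF P] by metis
  let ?M = "(\<lambda>(i, r). Poly_Mapping.single i r) ` ({0..int K} \<times> D)"
  have "S \<subseteq> Q.span ?M"
  proof
    fix q assume q: "q \<in> S"
    have "Poly_Mapping.single i (Poly_Mapping.lookup q i) \<in> Q.span ?M"
      if i: "i \<in> Poly_Mapping.keys q" for i
    proof -
      interpret single: Vector_Spaces.linear scale "skew_scale scale" "Poly_Mapping.single i"
        by (rule linear_single)
      have "Poly_Mapping.lookup q i \<in> R.span D"
        using S[OF q i] R.span_minimal[OF D(2) R.subspace_span] by blast
      then have "Poly_Mapping.single i (Poly_Mapping.lookup q i)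
          \<in> Q.span (Poly_Mapping.single i ` D)"
        unfolding single.span_image by (rule imageI)
      moreover have "Poly_Mapping.single i ` D \<subseteq> ?M" using S[OF q i] by auto
      ultimately show ?thesis using Q.span_mono by blast
    qed
    then show "q \<in> Q.span ?M"
      by (subst laurent_expansion) (rule Q.span_sum)
  qed
  then have "Q.dim S \<le> card ?M" by (rule Q.dim_le_card) (simp add: D(1))
  also have "\<dots> \<le> card ({0..int K} \<times> D)" by (rule card_image_le) (simp add: D(1))
  also have "\<dots> = (K + 1) * R.dim P" by (simp add: card_cartesian_product D(3) nat_add_distrib)
  finally show ?thesis .
qed

lemma space_power_degree_le:
  assumes W: "\<And>w i. w \<in> W \<Longrightarrow> i \<in> Poly_Mapping.keys w \<Longrightarrow> i \<le> int d"
    and "q \<in> Q.space_power W N" "i \<in> Poly_Mapping.keys q"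
  shows "i \<le> int (d * N)"
proof -
  define D where "D c = {q :: int \<Rightarrow>\<^sub>0 'r. \<forall>i > int c. Poly_Mapping.lookup q i = 0}" for c
  have keys: "q \<in> D c \<longleftrightarrow> (\<forall>i \<in> Poly_Mapping.keys q. i \<le> int c)" for q c
    unfolding D_def mem_Collect_eq in_keys_iff Ball_def by (meson linorder_not_less)
  have "foldr (skew_mult \<sigma>) xs skew_one \<in> D (d * length xs)" if "set xs \<subseteq> W" for xs
    using that
  proof (induction xs)
    case Nil
    show ?case by (simp add: D_def lookup_single)
  next
    case (Cons x xs)
    show ?case unfolding D_def
    proof (intro CollectI allI impI)
      fix m assume m: "m > int (d * length (x # xs))"
      have "Poly_Mapping.lookup (skew_mult \<sigma> x (foldr (skew_mult \<sigma>) xs skew_one)) m \<in> {0}"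
      proof (rule lookup_skew_mult_mem[OF R.subspace_single_0])
        fix i j assume ij: "i \<in> Poly_Mapping.keys x"
          "j \<in> Poly_Mapping.keys (foldr (skew_mult \<sigma>) xs skew_one)" "i + j = m"
        have "i \<le> int d" using W[OF _ ij(1)] Cons.prems by simp
        moreover have "j \<le> int (d * length xs)" using Cons.IH Cons.prems ij(2) keys by simp
        ultimately have False using m ij(3) by (simp add: algebra_simps)
        then show "Poly_Mapping.lookup x i * int_iterate \<sigma> i
            (Poly_Mapping.lookup (foldr (skew_mult \<sigma>) xs skew_one) j) \<in> {0}" ..
      qed
      then show "Poly_Mapping.lookup (foldr (skew_mult \<sigma>) (x # xs) skew_one) m = 0" by simp
    qed
  qed
  moreover have "Q.subspace (D c)" for c
    by (auto simp: Q.subspace_def D_def lookup_add lookup_skew_scale)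
  ultimately have "Q.space_power W N \<subseteq> D (d * N)"
    unfolding Q.space_power_def by (intro Q.span_minimal) auto
  with assms keys show ?thesis by blast
qed

lemma subalgebra_space_power:
  assumes "Q.subalgebra B" "W \<subseteq> B"
  shows "Q.space_power W N \<subseteq> B"
proof -
  have "foldr (skew_mult \<sigma>) xs skew_one \<in> B" if "set xs \<subseteq> W" for xs
    using that assms by (induction xs) (auto simp: Q.subalgebra_def)
  then show ?thesis
    unfolding Q.space_power_def using assms(1)
    by (intro Q.span_minimal) (auto simp: Q.subalgebra_def)
qed

lemma finite_degree_bound:
  assumes "finite F"
  obtains d where "d \<ge> 1" "\<And>q i. q \<in> F \<Longrightarrow> i \<in> Poly_Mapping.keys (q :: int \<Rightarrow>\<^sub>0 'r) \<Longrightarrow> i \<le> int d"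
proof -
  let ?I = "insert 1 (\<Union>q\<in>F. Poly_Mapping.keys q)"
  have fin: "finite ?I" using assms by simp
  have "1 \<le> Max ?I" by (rule Max_ge[OF fin]) simp
  moreover have "i \<le> Max ?I" if "q \<in> F" "i \<in> Poly_Mapping.keys q" for q i
    by (rule Max_ge[OF fin]) (use that in auto)
  ultimately show thesis using that[of "nat (Max ?I)"] by auto
qed

lemma fd_subspace_degree_bound:
  assumes "Q.fd_subspace W"
  obtains d where "d \<ge> 1" "\<And>w i. w \<in> W \<Longrightarrow> i \<in> Poly_Mapping.keys w \<Longrightarrow> i \<le> int d"
proof -
  obtain F where F: "finite F" "W = Q.span F" using assms by (auto simp: Q.fd_subspace_def)
  obtain d where d: "d \<ge> 1" "\<And>q i. q \<in> F \<Longrightarrow> i \<in> Poly_Mapping.keys q \<Longrightarrow> i \<le> int d"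
    by (rule finite_degree_bound[OF F(1)]) blast
  let ?D = "{q. \<forall>i > int d. Poly_Mapping.lookup q i = (0 :: 'r)}"
  have "F \<subseteq> ?D" using d(2) by (fastforce simp: in_keys_iff)
  moreover have "Q.subspace ?D"
    by (auto simp: Q.subspace_def lookup_add lookup_skew_scale)
  ultimately have "W \<subseteq> ?D" unfolding F(2) by (rule Q.span_minimal)
  then have "i \<le> int d" if "w \<in> W" "i \<in> Poly_Mapping.keys w" for w i
    using that by (force simp: in_keys_iff)
  with d(1) that show thesis by blast
qed

section \<open>Comparison of growth functions\<close>

text \<open>
  The exponent \<open>e\<close> is the same for all \<open>W\<close>, which makes the bound on the GK dimension of \<open>B\<close>
  uniform; only the rescaling factor \<open>d\<close>, which bounds the degrees in \<open>W\<close>, varies, and it does not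
  affect either kind of growth.  The factor \<open>d N + 1\<close> counts the degrees occurring in \<open>W\<^sup>N\<close>.
\<close>

lemma growth_domination:
  assumes A: "big_subalgebra A"
    and B: "N_graded_subalgebra B" "locally_finite B" "Q.finitely_generated B"
  obtains V\<^sub>0 e where "Q.fd_subspace V\<^sub>0" "V\<^sub>0 \<subseteq> A"
    and "\<And>W. Q.fd_subspace W \<Longrightarrow> W \<subseteq> B \<Longrightarrow> \<exists>d\<ge>1. \<forall>N\<ge>1.
      Q.dim (Q.space_power W N) \<le> (d * N + 1) * Q.dim (Q.space_power V\<^sub>0 (d * N)) ^ e"
proof -
  obtain n u u' S where n: "n \<ge> 1" and u: "u \<in> graded_coeffs A n" "u * u' = 1"
    and S: "multiplicative_system S"
      "\<forall>s\<in>S. nonzerodivisor_in (R.subalgebra hull ((\<lambda>v. v * u') ` graded_coeffs A n)) s"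
      "is_localization_of (R.subalgebra hull ((\<lambda>v. v * u') ` graded_coeffs A n)) S"
    using A unfolding big_subalgebra_def Let_def by blast
  define U where "U = graded_coeffs A n"
  define V where "V = (\<lambda>v. v * u') ` U"
  define V\<^sub>0 where "V\<^sub>0 = Poly_Mapping.single (int n) ` U"
  have "1 \<in> V" using u by (auto simp: V_def U_def intro!: image_eqI[of _ _ u])
  obtain E where E: "finite E" "U = R.span E"
    using A unfolding big_subalgebra_def locally_finite_def R.fd_subspace_def U_def by metis
  have U: "R.finite_dim U" using E by (auto simp: R.finite_dim_def)
  have V_eq: "V = R.span ((*) u' ` E)"
  proof -
    interpret times: Vector_Spaces.linear scale scale "(*) u'" by (rule R.linear_times)
    have "V = (*) u' ` U" by (simp add: V_def mult.commute)
    then show ?thesis by (simp add: E(2) times.span_image)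
  qed
  then have V: "R.finite_dim V" using E(1) by (auto simp: R.finite_dim_def)
  have V0: "Q.fd_subspace V\<^sub>0"
  proof -
    interpret single: Vector_Spaces.linear scale "skew_scale scale" "Poly_Mapping.single (int n)"
      by (rule linear_single)
    show ?thesis using E by (auto simp: Q.fd_subspace_def V\<^sub>0_def simp flip: single.span_image)
  qed
  have V0_A: "V\<^sub>0 \<subseteq> A" by (auto simp: V\<^sub>0_def U_def graded_coeffs_def)

  \<comment> \<open>The coefficients of \<open>B\<close> in the degrees of its generators have a finite
    spanning set, to which \<open>common_denominator\<close> can be applied.\<close>
  obtain X where X: "finite X" "B = Q.subalgebra hull X"
    using B(3) unfolding Q.finitely_generated_def by blast
  obtain \<delta> where \<delta>: "\<And>x i. x \<in> X \<Longrightarrow> i \<in> Poly_Mapping.keys x \<Longrightarrow> i \<le> int \<delta>"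
    by (rule finite_degree_bound[OF X(1)]) blast
  define G where "G = (\<Union>i\<le>\<delta>. graded_coeffs B i)"
  have "\<forall>i. \<exists>H. finite H \<and> graded_coeffs B i = R.span H"
    using B(2) by (simp add: locally_finite_def R.fd_subspace_def)
  then obtain H where H: "\<And>i. finite (H i)" "\<And>i. graded_coeffs B i = R.span (H i)" by metis
  have G_span: "G \<subseteq> R.span (\<Union>i\<le>\<delta>. H i)"
    unfolding G_def H(2) by (intro UN_least R.span_mono) auto
  then have G: "R.finite_dim G" using H(1) unfolding R.finite_dim_def by blast
  have "skew_one \<in> B" using B(1) by (auto simp: N_graded_subalgebra_def Q.subalgebra_def)
  then have one_G: "1 \<in> G" by (auto simp: G_def graded_coeffs_def intro!: bexI[of _ 0])

  \<comment> \<open>A common denominator \<open>s\<close>, and a power of \<open>V\<close> that contains all numerators.\<close>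
  have "S \<subseteq> R.subalgebra hull V"
    using S(2) by (auto simp: nonzerodivisor_in_def V_def U_def)
  then obtain s where s: "s dvd 1" "\<And>h. h \<in> (\<Union>i\<le>\<delta>. H i) \<Longrightarrow> h * s \<in> R.subalgebra hull V"
    using R.common_denominator[OF R.subalgebra_hull S(1) _ S(3)[folded U_def V_def]] H(1)
    by (metis (no_types, lifting) U_def V_def finite_UN finite_atMost)
  have "finite ((\<lambda>h. h * s) ` (\<Union>i\<le>\<delta>. H i))" "(\<lambda>h. h * s) ` (\<Union>i\<le>\<delta>. H i) \<subseteq> R.subalgebra hull V"
    using H(1) s(2) by auto
  then obtain p where p: "(\<lambda>h. h * s) ` (\<Union>i\<le>\<delta>. H i) \<subseteq> R.span (V ^ p)"
    by (rule R.finite_subset_generated_subalgebra[OF \<open>1 \<in> V\<close>])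
  have sG: "s * g \<in> R.span (V ^ p)" if "g \<in> G" for g
  proof -
    interpret times: Vector_Spaces.linear scale scale "(*) s" by (rule R.linear_times)
    have "s * g \<in> R.span ((*) s ` (\<Union>i\<le>\<delta>. H i))"
      unfolding times.span_image using that G_span by blast
    moreover have "(*) s = (\<lambda>h. h * s)" by (simp add: fun_eq_iff mult.commute)
    ultimately show ?thesis
      using R.span_minimal[OF p R.subspace_span] by auto
  qed

  have "\<exists>d\<ge>1. \<forall>N\<ge>1.
      Q.dim (Q.space_power W N) \<le> (d * N + 1) * Q.dim (Q.space_power V\<^sub>0 (d * N)) ^ (n * p)"
    if W: "Q.fd_subspace W" "W \<subseteq> B" for W
  proof -
    obtain d where d: "d \<ge> 1" "\<And>w i. w \<in> W \<Longrightarrow> i \<in> Poly_Mapping.keys w \<Longrightarrow> i \<le> int d"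
      by (rule fd_subspace_degree_bound[OF W(1)]) blast
    have "Q.dim (Q.space_power W N) \<le> (d * N + 1) * Q.dim (Q.space_power V\<^sub>0 (d * N)) ^ (n * p)"
      if N: "N \<ge> 1" for N
    proof -
      define K where "K = d * N"
      have K: "K \<ge> 1" using d(1) N by (simp add: K_def)
      have coeffs: "0 \<le> i \<and> i \<le> int K \<and> Poly_Mapping.lookup q i \<in> R.span (twisted_prod G K)"
        if q: "q \<in> Q.space_power W N" "i \<in> Poly_Mapping.keys q" for q i
      proof -
        have qB: "q \<in> B"
          using subalgebra_space_power[OF _ W(2)] B(1) q(1)
          unfolding N_graded_subalgebra_def by blast
        have i: "0 \<le> i" "i \<le> int K"
          using N_gradedD(1)[OF B(1) qB q(2)] space_power_degree_le[OF d(2) q]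
          unfolding K_def by auto
        \<comment> \<open>In degree \<open>0\<close> the coefficient lies in \<open>G\<close>, the twisted product with one factor.\<close>
        have mem: "Poly_Mapping.lookup q i \<in> R.span (twisted_prod G m)"
          if "m = max 1 (nat i)" for m
        proof (cases "i = 0")
          case True
          have "Poly_Mapping.lookup q i \<in> G"
            using N_gradedD(2)[OF B(1) qB q(2)] True by (auto simp: G_def)
          then show ?thesis
            using that True by (simp add: twisted_prod_def R.span_base)
        next
          case False
          then have "m \<ge> 1" "i = int m" using that i by auto
          moreover from \<open>m \<ge> 1\<close> have "Poly_Mapping.lookup q (int m) \<in> R.span (twisted_prod G m)"
            unfolding G_def
            by (intro coefficient_in_twisted_prod[OF B(1) X(2) _ qB]) (auto dest: \<delta>)
          ultimately show ?thesis by simp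
        qed
        have "max 1 (nat i) \<le> K" using K i by simp
        then show ?thesis
          using i mem[OF refl] R.span_mono[OF twisted_prod_mono[OF one_G]] by blast
      qed
      have "Q.dim (Q.space_power W N) \<le> (K + 1) * R.dim (twisted_prod G K)"
      proof (rule dim_bounded_degree_le)
        show "R.finite_dim (twisted_prod G K)"
          by (rule finite_dim_twisted_prod[OF G])
      qed (rule coeffs)
      also have "\<dots> \<le> (K + 1) * R.dim (\<Prod>q<K. (\<sigma> ^^ (q * n)) ` V) ^ (n * p)"
        by (intro mult_le_mono2 dim_twisted_prod_le[OF \<open>1 \<in> V\<close> V n s(1)] sG)
      also have "\<dots> \<le> (K + 1) * Q.dim (Q.space_power V\<^sub>0 K) ^ (n * p)"
        unfolding V_def V\<^sub>0_def
        by (intro mult_le_mono2 power_mono dim_veronese_le[OF u(2) U]) simp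
      finally show ?thesis by (simp add: K_def)
    qed
    with d(1) show ?thesis by blast
  qed
  with V0 V0_A that show thesis by blast
qed

end

section \<open>Passage to the limit\<close>

text \<open>
  The bound for \<open>f\<close> must not depend on \<open>d\<close>, because \<open>d\<close> varies with the finite-dimensional subspace
  over which the GK dimension takes a supremum.  With \<open>K = dN\<close>, one has \<open>K + 1 \<le> 2K \<le> N\<^sup>2\<close> as soon as
  \<open>N \<ge> 2d\<close>, which absorbs \<open>d\<close> at the cost of the factor \<open>2\<close>.
\<close>

lemma limsup_log_le:
  fixes f g :: "nat \<Rightarrow> nat"
  assumes c: "0 \<le> c" "limsup (\<lambda>n. ereal (log (real n) (real (g n)))) < ereal c"
    and d: "d \<ge> 1" and f: "\<And>N. N \<ge> 1 \<Longrightarrow> f N \<le> (d * N + 1) * g (d * N) ^ e"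
  shows "limsup (\<lambda>n. ereal (log (real n) (real (f n)))) \<le> ereal (2 * (1 + c * e))"
proof (rule Limsup_bounded)
  have "\<forall>\<^sub>F n in sequentially. log (real n) (real (g n)) < c"
    using Limsup_lessD[OF c(2)] by simp
  then obtain M where M: "\<And>n. n \<ge> M \<Longrightarrow> log (real n) (real (g n)) < c"
    by (auto simp: eventually_sequentially)
  have "log (real N) (real (f N)) \<le> 2 * (1 + c * e)" if N: "N \<ge> max M (2 * d)" for N
  proof (cases "f N = 0")
    case True
    then show ?thesis using c(1) by (simp add: log_def)
  next
    case False
    define K where "K = d * N"
    have "N \<ge> 2" "N \<ge> M" "N \<ge> 2 * d" using N d by auto
    have "N \<le> K" using d by (simp add: K_def)
    then have K: "K \<ge> 2" "K \<ge> M" using \<open>N \<ge> 2\<close> \<open>N \<ge> M\<close> by auto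
    have g: "real (g K) \<le> real K powr c"
    proof (cases "g K = 0")
      case False
      then show ?thesis using M[OF K(2)] K(1) by (simp add: log_less_iff)
    qed simp
    have "real (f N) \<le> real ((K + 1) * g K ^ e)"
      using f[of N] \<open>N \<ge> 2\<close> unfolding K_def of_nat_le_iff by simp
    also have "\<dots> = real (K + 1) * real (g K) ^ e" by (simp only: of_nat_mult of_nat_power)
    also have "\<dots> \<le> real (2 * K) * (real (2 * K) powr c) ^ e"
    proof (intro mult_mono power_mono)
      show "real (g K) \<le> real (2 * K) powr c"
        using g powr_mono2[OF c(1), of "real K" "real (2 * K)"] by linarith
    qed (use K in auto)
    also have "\<dots> = real (2 * K) powr (1 + c * e)"
    proof -
      have "(real (2 * K) powr c) ^ e = real (2 * K) powr (c * e)"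
        using K by (subst powr_realpow[symmetric]) (auto simp: powr_powr)
      then show ?thesis using K by (simp add: powr_add)
    qed
    also have "\<dots> \<le> (real N powr 2) powr (1 + c * e)"
    proof (rule powr_mono2)
      have "2 * K \<le> N * N" using \<open>N \<ge> 2 * d\<close> by (simp add: K_def)
      then show "real (2 * K) \<le> real N powr 2"
        using \<open>N \<ge> 2\<close> by (simp add: power2_eq_square flip: of_nat_mult)
    qed (use c(1) in auto)
    also have "\<dots> = real N powr (2 * (1 + c * e))" by (rule powr_powr)
    finally show ?thesis using False \<open>N \<ge> 2\<close> by (simp add: log_le_iff)
  qed
  then show "\<forall>\<^sub>F n in sequentially. ereal (log (real n) (real (f n))) \<le> ereal (2 * (1 + c * e))"
    by (intro eventually_sequentiallyI[of "max M (2 * d)"]) simp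
qed

text \<open>
  If \<open>g K \<le> (1 + \<epsilon>)\<^sup>K\<close> for large \<open>K\<close>, then the \<open>N\<close>-th root of \<open>f N\<close> is asymptotically at most
  \<open>(1 + \<epsilon>)\<^bsup>de\<^esup>\<close>, which tends to \<open>1\<close> with \<open>\<epsilon> \<rightarrow> 0\<close> for fixed \<open>d\<close> and \<open>e\<close>.
\<close>

lemma limsup_root_le_one:
  fixes f g :: "nat \<Rightarrow> nat"
  assumes g: "limsup (\<lambda>n. ereal (root n (real (g n)))) \<le> 1"
    and d: "d \<ge> 1" and f: "\<And>N. N \<ge> 1 \<Longrightarrow> f N \<le> (d * N + 1) * g (d * N) ^ e"
  shows "limsup (\<lambda>n. ereal (root n (real (f n)))) \<le> 1"
proof -
  have bound: "limsup (\<lambda>n. ereal (root n (real (f n)))) \<le> ereal ((1 + \<epsilon>) ^ (d * e))"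
    if \<epsilon>: "\<epsilon> > 0" for \<epsilon> :: real
  proof -
    have "limsup (\<lambda>n. ereal (root n (real (g n)))) < ereal (1 + \<epsilon>)"
      using g by (rule order_le_less_trans) (use \<epsilon> in simp)
    from Limsup_lessD[OF this] obtain M where
      M: "\<And>n. n \<ge> M \<Longrightarrow> root n (real (g n)) < 1 + \<epsilon>"
      by (auto simp: eventually_sequentially)
    let ?h = "\<lambda>N. root N (real (d * N + 1)) * (1 + \<epsilon>) ^ (d * e)"
    have "root N (real (f N)) \<le> ?h N" if N: "N \<ge> max M 1" for N
    proof -
      define K where "K = d * N"
      have "N \<le> K" using d by (simp add: K_def)
      then have K: "K \<ge> 1" "K \<ge> M" using N by auto
      have "real (g K) = root K (real (g K)) ^ K" using K by simp
      also have "\<dots> \<le> (1 + \<epsilon>) ^ K"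
        using M[OF K(2)] by (intro power_mono) (auto intro: real_root_ge_zero)
      finally have gK: "real (g K) \<le> (1 + \<epsilon>) ^ K" .
      have "real (f N) \<le> real ((K + 1) * g K ^ e)"
        using f[of N] N unfolding K_def of_nat_le_iff by simp
      also have "\<dots> = real (K + 1) * real (g K) ^ e" by (simp only: of_nat_mult of_nat_power)
      also have "\<dots> \<le> real (K + 1) * ((1 + \<epsilon>) ^ K) ^ e"
        using gK by (intro mult_left_mono power_mono) auto
      also have "((1 + \<epsilon>) ^ K) ^ e = ((1 + \<epsilon>) ^ (d * e)) ^ N"
        unfolding power_mult[symmetric] K_def by (simp only: ac_simps)
      finally have "root N (real (f N)) \<le> root N (real (K + 1) * ((1 + \<epsilon>) ^ (d * e)) ^ N)"
        using N by simp
      also have "\<dots> = ?h N"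
        using N \<epsilon> unfolding real_root_mult K_def by (subst real_root_power_cancel) auto
      finally show ?thesis .
    qed
    then have "\<forall>\<^sub>F N in sequentially. ereal (root N (real (f N))) \<le> ereal (?h N)"
      by (intro eventually_sequentiallyI[of "max M 1"]) simp
    then have "limsup (\<lambda>n. ereal (root n (real (f n)))) \<le> limsup (\<lambda>N. ereal (?h N))"
      by (rule Limsup_mono)
    also have "\<dots> = ereal ((1 + \<epsilon>) ^ (d * e))"
    proof -
      have "(\<lambda>N. root N (real (d * N + 1))) \<longlonglongrightarrow> 1"
      proof (rule tendsto_sandwich[where f = "\<lambda>_. 1"])
        show "(\<lambda>N. root N (real (2 * d)) * root N (real N)) \<longlonglongrightarrow> 1"
          using tendsto_mult[OF LIMSEQ_root_const LIMSEQ_root, of "real (2 * d)"] d by simp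
        show "\<forall>\<^sub>F N in sequentially. root N (real (d * N + 1))
            \<le> root N (real (2 * d)) * root N (real N)"
        proof (rule eventually_sequentiallyI[of 1])
          fix N :: nat assume "N \<ge> 1"
          then have "d * N + 1 \<le> 2 * d * N"
            using d mult_le_mono[of 1 d 1 N] by simp
          then have "real (d * N + 1) \<le> real (2 * d) * real N"
            unfolding of_nat_mult[symmetric] of_nat_le_iff .
          then show "root N (real (d * N + 1)) \<le> root N (real (2 * d)) * root N (real N)"
            unfolding real_root_mult[symmetric] using \<open>N \<ge> 1\<close> by simp
        qed
        show "\<forall>\<^sub>F N in sequentially. 1 \<le> root N (real (d * N + 1))"
          by (rule eventually_sequentiallyI[of 1]) simp
        show "(\<lambda>_. 1 :: real) \<longlonglongrightarrow> 1" by simp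
      qed
      then have "?h \<longlonglongrightarrow> 1 * (1 + \<epsilon>) ^ (d * e)"
        by (intro tendsto_mult tendsto_const)
      then have "(\<lambda>N. ereal (?h N)) \<longlonglongrightarrow> ereal ((1 + \<epsilon>) ^ (d * e))" by simp
      then show ?thesis by (intro lim_imp_Limsup) auto
    qed
    finally show ?thesis .
  qed
  have "((\<lambda>\<epsilon>::real. ereal ((1 + \<epsilon>) ^ (d * e))) \<longlongrightarrow> ereal ((1 + 0) ^ (d * e))) (at_right 0)"
    by (intro tendsto_intros)
  then have "limsup (\<lambda>n. ereal (root n (real (f n)))) \<le> ereal ((1 + 0) ^ (d * e))"
  proof (rule tendsto_lowerbound)
    show "\<forall>\<^sub>F \<epsilon> in at_right 0.
        limsup (\<lambda>n. ereal (root n (real (f n)))) \<le> ereal ((1 + \<epsilon>) ^ (d * e))"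
      using eventually_at_right_less[of 0] by (rule eventually_mono) (rule bound)
  qed simp
  then show ?thesis by (simp add: one_ereal_def)
qed

context skew_laurent
begin

lemma finite_GKdim_if_big_subalgebra:
  assumes "big_subalgebra A" "Q.finite_GKdim A"
    and "N_graded_subalgebra B" "locally_finite B" "Q.finitely_generated B"
  shows "Q.finite_GKdim B"
proof -
  obtain V\<^sub>0 e where V0: "Q.fd_subspace V\<^sub>0" "V\<^sub>0 \<subseteq> A"
    and dom: "\<And>W. Q.fd_subspace W \<Longrightarrow> W \<subseteq> B \<Longrightarrow> \<exists>d\<ge>1. \<forall>N\<ge>1.
      Q.dim (Q.space_power W N) \<le> (d * N + 1) * Q.dim (Q.space_power V\<^sub>0 (d * N)) ^ e"
    by (rule growth_domination[OF assms(1,3-5)]) blast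
  let ?l = "\<lambda>V. limsup (\<lambda>n. ereal (log (real n) (real (Q.dim (Q.space_power V n)))))"
  have "?l V\<^sub>0 \<le> Q.GKdim A"
    unfolding Q.GKdim_def by (rule SUP_upper) (use V0 in simp)
  then have "?l V\<^sub>0 < \<infinity>"
    using assms(2) unfolding Q.finite_GKdim_def by (rule order_le_less_trans)
  then obtain c where "?l V\<^sub>0 < ereal c" by (metis ereal_dense2 less_ereal.simps)
  then have c: "?l V\<^sub>0 < ereal (max c 0)"
    by (rule order_less_le_trans) simp
  have "?l W \<le> ereal (2 * (1 + max c 0 * e))" if W: "Q.fd_subspace W" "W \<subseteq> B" for W
  proof -
    obtain d where "d \<ge> 1" "\<And>N. N \<ge> 1 \<Longrightarrow>
        Q.dim (Q.space_power W N) \<le> (d * N + 1) * Q.dim (Q.space_power V\<^sub>0 (d * N)) ^ e"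
      using dom[OF W] by blast
    then show ?thesis by (intro limsup_log_le[OF _ c]) auto
  qed
  then have "Q.GKdim B \<le> ereal (2 * (1 + max c 0 * e))"
    unfolding Q.GKdim_def by (intro SUP_least) auto
  then show ?thesis
    unfolding Q.finite_GKdim_def by (rule order_le_less_trans) simp
qed

lemma subexponential_growth_if_big_subalgebra:
  assumes "big_subalgebra A" "Q.subexponential_growth A"
    and "N_graded_subalgebra B" "locally_finite B" "Q.finitely_generated B"
  shows "Q.subexponential_growth B"
proof -
  obtain V\<^sub>0 e where V0: "Q.fd_subspace V\<^sub>0" "V\<^sub>0 \<subseteq> A"
    and dom: "\<And>W. Q.fd_subspace W \<Longrightarrow> W \<subseteq> B \<Longrightarrow> \<exists>d\<ge>1. \<forall>N\<ge>1.
      Q.dim (Q.space_power W N) \<le> (d * N + 1) * Q.dim (Q.space_power V\<^sub>0 (d * N)) ^ e"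
    by (rule growth_domination[OF assms(1,3-5)]) blast
  let ?l = "\<lambda>V. limsup (\<lambda>n. ereal (root n (real (Q.dim (Q.space_power V n)))))"
  have "?l V\<^sub>0 \<le> (SUP V\<in>{V. Q.fd_subspace V \<and> V \<subseteq> A}. ?l V)"
    by (rule SUP_upper) (use V0 in simp)
  also have "\<dots> \<le> 1"
    using assms(2) unfolding Q.subexponential_growth_def Q.exponential_growth_def
    by (simp add: not_less)
  finally have V0_le: "?l V\<^sub>0 \<le> 1" .
  have "?l W \<le> 1" if W: "Q.fd_subspace W" "W \<subseteq> B" for W
  proof -
    obtain d where "d \<ge> 1" "\<And>N. N \<ge> 1 \<Longrightarrow>
        Q.dim (Q.space_power W N) \<le> (d * N + 1) * Q.dim (Q.space_power V\<^sub>0 (d * N)) ^ e"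
      using dom[OF W] by blast
    then show ?thesis by (rule limsup_root_le_one[OF V0_le])
  qed
  then have "(SUP V\<in>{V. Q.fd_subspace V \<and> V \<subseteq> B}. ?l V) \<le> 1"
    by (intro SUP_least) auto
  then show ?thesis
    unfolding Q.subexponential_growth_def Q.exponential_growth_def by (simp add: not_less)
qed

end

theorem proposition1p4:
  fixes scale :: "'k::field \<Rightarrow> 'r::{comm_ring,comm_monoid_mult} \<Rightarrow> 'r"
    and \<sigma> :: "'r \<Rightarrow> 'r"
    and A :: "(int \<Rightarrow>\<^sub>0 'r) set"
  assumes "skew_laurent scale \<sigma>"
    and "skew_laurent.big_subalgebra scale \<sigma> A"
  shows "(k_algebra.finite_GKdim (skew_scale scale) (skew_mult \<sigma>) skew_one A \<longrightarrow>
      (\<forall>B. skew_laurent.N_graded_subalgebra scale \<sigma> B \<and> skew_laurent.locally_finite scale B \<and>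
          k_algebra.finitely_generated (skew_scale scale) (skew_mult \<sigma>) skew_one B \<longrightarrow>
        k_algebra.finite_GKdim (skew_scale scale) (skew_mult \<sigma>) skew_one B)) \<and>
    (k_algebra.subexponential_growth (skew_scale scale) (skew_mult \<sigma>) skew_one A \<longrightarrow>
      (\<forall>B. skew_laurent.N_graded_subalgebra scale \<sigma> B \<and> skew_laurent.locally_finite scale B \<and>
          k_algebra.finitely_generated (skew_scale scale) (skew_mult \<sigma>) skew_one B \<longrightarrow>
        k_algebra.subexponential_growth (skew_scale scale) (skew_mult \<sigma>) skew_one B))"
proof -
  interpret skew_laurent scale \<sigma> by (rule assms(1))
  show ?thesis
    using assms(2) finite_GKdim_if_big_subalgebra subexponential_growth_if_big_subalgebra by blast
qed

end
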